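(* Given a graph $G$ with $n$ vertices and $m$ edges and an edge $xy$ of $G$, one can decide whether $xy$ is an avoidable edge of $G$ in $O(n\cdot m)$ time.
   Context: All graphs are finite, simple and undirected. A $P_4$ is an induced path on four vertices; the middle edge of a $P_4=a,b,c,d$ is $bc$. An edge $uv$ is simplicial if there is no $P_4$ having $uv$ as middle edge, and avoidable if either it is simplicial or every $P_4$ with middle edge $uv$ is contained in an induced cycle. *)

theory Defs
  imports Main
begin

section \<open>Finite simple undirected graphs\<close>

definition ugraph :: "'a set \<Rightarrow> 'a set set \<Rightarrow> bool" where
  "ugraph V E \<longleftrightarrow> finite V \<and> (\<forall>e\<in>E. e \<subseteq> V \<and> card e = 2)"

definition induced_path :: "'a set \<Rightarrow> 'a set set \<Rightarrow> 'a list \<Rightarrow> bool" where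
  "induced_path V E p \<longleftrightarrow> p \<noteq> [] \<and> distinct p \<and> set p \<subseteq> V \<and>
     (\<forall>i<length p. \<forall>j<length p. {p ! i, p ! j} \<in> E \<longleftrightarrow> j = Suc i \<or> i = Suc j)"

definition induced_cycle :: "'a set \<Rightarrow> 'a set set \<Rightarrow> 'a list \<Rightarrow> bool" where
  "induced_cycle V E c \<longleftrightarrow> 3 \<le> length c \<and> distinct c \<and> set c \<subseteq> V \<and>
     (\<forall>i<length c. \<forall>j<length c. {c ! i, c ! j} \<in> E \<longleftrightarrow>
        j = Suc i mod length c \<or> i = Suc j mod length c)"

definition P4 :: "'a set \<Rightarrow> 'a set set \<Rightarrow> 'a list \<Rightarrow> bool" where
  "P4 V E p \<longleftrightarrow> induced_path V E p \<and> length p = 4"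

definition middle_edge :: "'a list \<Rightarrow> 'a set" where
  "middle_edge p = {p ! 1, p ! 2}"

definition simplicial_edge :: "'a set \<Rightarrow> 'a set set \<Rightarrow> 'a set \<Rightarrow> bool" where
  "simplicial_edge V E e \<longleftrightarrow> e \<in> E \<and> \<not> (\<exists>p. P4 V E p \<and> middle_edge p = e)"

text \<open>Paths and cycles below are induced, so a path is contained in a cycle as a subgraph
  iff its vertex set is.\<close>

definition avoidable_edge :: "'a set \<Rightarrow> 'a set set \<Rightarrow> 'a set \<Rightarrow> bool" where
  "avoidable_edge V E e \<longleftrightarrow> e \<in> E \<and>
     (simplicial_edge V E e \<or>
      (\<forall>p. P4 V E p \<and> middle_edge p = e \<longrightarrow>
         (\<exists>c. induced_cycle V E c \<and> set p \<subseteq> set c)))"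


section \<open>Random access machines\<close>

text \<open>The unit-cost random access machine over the natural numbers, with addition and truncated
  subtraction as the only arithmetic. A program mentions finitely many registers;
  the unbounded memory is accessed through addresses held in registers. The machine halts
  when the program counter leaves the program.\<close>

type_synonym reg = nat

datatype instr =
    Const reg nat
  | Copy reg reg
  | Add reg reg reg
  | Sub reg reg reg
  | Load reg reg      \<comment> \<open>\<open>Load r s\<close>: \<open>r := mem[s]\<close>\<close>
  | Store reg reg     \<comment> \<open>\<open>Store r s\<close>: \<open>mem[r] := s\<close>\<close>
  | Jump nat
  | JumpZero reg nat

type_synonym program = "instr list"

datatype config = Config (pc: nat) (regs: "reg \<Rightarrow> nat") (mem: "nat \<Rightarrow> nat")

fun exec :: "instr \<Rightarrow> config \<Rightarrow> config" where
  "exec (Const r k) (Config p R M) = Config (Suc p) (R(r := k)) M"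
| "exec (Copy r s) (Config p R M) = Config (Suc p) (R(r := R s)) M"
| "exec (Add r s t) (Config p R M) = Config (Suc p) (R(r := R s + R t)) M"
| "exec (Sub r s t) (Config p R M) = Config (Suc p) (R(r := R s - R t)) M"
| "exec (Load r s) (Config p R M) = Config (Suc p) (R(r := M (R s))) M"
| "exec (Store r s) (Config p R M) = Config (Suc p) R (M(R r := R s))"
| "exec (Jump l) (Config p R M) = Config l R M"
| "exec (JumpZero r l) (Config p R M) = Config (if R r = 0 then l else Suc p) R M"

definition halted :: "program \<Rightarrow> config \<Rightarrow> bool" where
  "halted P s \<longleftrightarrow> length P \<le> pc s"

definition step :: "program \<Rightarrow> config \<Rightarrow> config" where
  "step P s = (if halted P s then s else exec (P ! pc s) s)"

definition initial :: "nat list \<Rightarrow> config" where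
  "initial w = Config 0 (\<lambda>_. 0) (\<lambda>i. if i < length w then w ! i else 0)"

text \<open>On input \<open>w\<close> the program halts after at most \<open>T\<close> steps, and register \<open>0\<close> then holds
  the truth value of \<open>b\<close>.\<close>

definition answers_within :: "program \<Rightarrow> nat list \<Rightarrow> bool \<Rightarrow> nat \<Rightarrow> bool" where
  "answers_within P w b T \<longleftrightarrow>
     (\<exists>t\<le>T. let s = (step P ^^ t) (initial w) in
        halted P s \<and> regs s 0 = (if b then 1 else 0))"


section \<open>Encoding of graphs\<close>

text \<open>The vertices are \<open>0, \<dots>, n - 1\<close>. Every edge is listed exactly once, in arbitrary order and
  with arbitrary orientation.\<close>

definition lists_edges :: "(nat \<times> nat) list \<Rightarrow> nat set set \<Rightarrow> bool" where
  "lists_edges es E \<longleftrightarrow>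
     distinct (map (\<lambda>(u, v). {u, v}) es) \<and> set (map (\<lambda>(u, v). {u, v}) es) = E"

definition encode :: "nat \<Rightarrow> (nat \<times> nat) list \<Rightarrow> nat \<Rightarrow> nat \<Rightarrow> nat list" where
  "encode n es x y = [n, length es, x, y] @ concat (map (\<lambda>(u, v). [u, v]) es)"

end

theory Submission
  imports Defs
begin

text \<open>
  Let \<open>W\<close> be the set of vertices outside the closed neighbourhoods of \<open>x\<close> and \<open>y\<close>. A \<open>P\<^sub>4\<close>
  \<open>a, x, y, b\<close> lies in an induced cycle iff \<open>a\<close> and \<open>b\<close> have neighbours in a common component of
  the subgraph induced by \<open>W\<close>: the rest of such a cycle runs through \<open>W\<close>, and conversely an induced
  path from \<open>a\<close> to \<open>b\<close> with interior in \<open>W\<close> closes up with \<open>x, y\<close> to an induced cycle.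

  The components of \<open>W\<close> are found by relabelling all vertices once per edge, in \<open>O(n)\<close> steps each. Then
  every \<open>a\<close> adjacent to \<open>x\<close> but not to \<open>y\<close> takes three passes over the edge list: mark the neighbours
  of \<open>a\<close> and their labels, mark every neighbour of a vertex of \<open>W\<close> with a marked label, and test that
  every \<open>b\<close> adjacent to \<open>y\<close> but not to \<open>x\<close> is marked.
\<close>


section \<open>Structured programs\<close>

text \<open>A loop carries a label of type \<open>'b\<close> that the compiler ignores; under a valuation
  \<open>\<beta> :: 'b \<Rightarrow> nat\<close> it bounds the number of iterations, so that one program, fixed for all inputs,
  has a running time \<open>cost \<beta> c\<close> depending on the input.\<close>

datatype 'b com =
    Ins instr
  | Seq "'b com" "'b com"  (infixr ";;" 60)
  | IfZ reg "'b com"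
  | IfNZ reg "'b com"
  | While 'b reg "'b com"

primrec csize :: "'b com \<Rightarrow> nat" where
  "csize (Ins i) = 1"
| "csize (c ;; d) = csize c + csize d"
| "csize (IfZ r c) = csize c + 2"
| "csize (IfNZ r c) = csize c + 1"
| "csize (While b r c) = csize c + 2"

primrec compile :: "nat \<Rightarrow> 'b com \<Rightarrow> program" where
  "compile p (Ins i) = [i]"
| "compile p (c ;; d) = compile p c @ compile (p + csize c) d"
| "compile p (IfZ r c) = JumpZero r (p + 2) # Jump (p + 2 + csize c) # compile (p + 2) c"
| "compile p (IfNZ r c) = JumpZero r (p + 1 + csize c) # compile (p + 1) c"
| "compile p (While b r c) = JumpZero r (p + 2 + csize c) # compile (p + 1) c @ [Jump p]"

lemma length_compile [simp]: "length (compile p c) = csize c"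
  by (induction c arbitrary: p) auto

primrec cost :: "('b \<Rightarrow> nat) \<Rightarrow> 'b com \<Rightarrow> nat" where
  "cost \<beta> (Ins i) = 1"
| "cost \<beta> (c ;; d) = cost \<beta> c + cost \<beta> d"
| "cost \<beta> (IfZ r c) = cost \<beta> c + 2"
| "cost \<beta> (IfNZ r c) = cost \<beta> c + 1"
| "cost \<beta> (While b r c) = \<beta> b * (cost \<beta> c + 2) + 1"

fun is_jump :: "instr \<Rightarrow> bool" where
  "is_jump (Jump l) = True"
| "is_jump (JumpZero r l) = True"
| "is_jump i = False"

type_synonym assertion = "(reg \<Rightarrow> nat) \<Rightarrow> (nat \<Rightarrow> nat) \<Rightarrow> bool"

primrec while_wp :: "(assertion \<Rightarrow> assertion) \<Rightarrow> reg \<Rightarrow> nat \<Rightarrow> assertion \<Rightarrow> assertion" where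
  "while_wp F r 0 Q R M \<longleftrightarrow> R r = 0 \<and> Q R M"
| "while_wp F r (Suc k) Q R M \<longleftrightarrow> R r \<noteq> 0 \<and> F (while_wp F r k Q) R M"

primrec wp :: "('b \<Rightarrow> nat) \<Rightarrow> 'b com \<Rightarrow> assertion \<Rightarrow> assertion" where
  "wp \<beta> (Ins i) Q R M \<longleftrightarrow>
     \<not> is_jump i \<and> (case exec i (Config 0 R M) of Config p R' M' \<Rightarrow> Q R' M')"
| "wp \<beta> (c ;; d) Q R M \<longleftrightarrow> wp \<beta> c (wp \<beta> d Q) R M"
| "wp \<beta> (IfZ r c) Q R M \<longleftrightarrow> (if R r = 0 then wp \<beta> c Q R M else Q R M)"
| "wp \<beta> (IfNZ r c) Q R M \<longleftrightarrow> (if R r = 0 then Q R M else wp \<beta> c Q R M)"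
| "wp \<beta> (While b r c) Q R M \<longleftrightarrow> (\<exists>k\<le>\<beta> b. while_wp (wp \<beta> c) r k Q R M)"


subsection \<open>Soundness of the compiler\<close>

definition code_at :: "program \<Rightarrow> nat \<Rightarrow> program \<Rightarrow> bool" where
  "code_at P p xs \<longleftrightarrow> (\<exists>ys zs. P = ys @ xs @ zs \<and> length ys = p)"

lemma code_at_appendD:
  assumes "code_at P p (xs @ ys)"
  shows "code_at P p xs" "code_at P (p + length xs) ys"
proof -
  obtain us vs where "P = us @ (xs @ ys) @ vs" "length us = p"
    using assms by (auto simp: code_at_def)
  then have "P = us @ xs @ (ys @ vs)" "P = (us @ xs) @ ys @ vs" "length (us @ xs) = p + length xs"
    by simp_all
  then show "code_at P p xs" "code_at P (p + length xs) ys"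
    using \<open>length us = p\<close> unfolding code_at_def by blast+
qed

lemma code_at_ConsD:
  assumes "code_at P p (i # xs)"
  shows "p < length P" "P ! p = i" "code_at P (Suc p) xs"
proof -
  show "code_at P (Suc p) xs" using assms code_at_appendD(2)[of P p "[i]" xs] by simp
  show "p < length P" "P ! p = i" using assms by (auto simp: code_at_def)
qed

definition runs_to :: "program \<Rightarrow> nat \<Rightarrow> nat \<Rightarrow> nat \<Rightarrow> assertion \<Rightarrow> assertion" where
  "runs_to P T p q Q R M \<longleftrightarrow>
     (\<exists>t\<le>T. \<exists>R' M'. (step P ^^ t) (Config p R M) = Config q R' M' \<and> Q R' M')"

lemma runs_to_refl: "Q R M \<Longrightarrow> runs_to P T p p Q R M"
  unfolding runs_to_def by (intro exI[of _ 0] conjI exI[of _ R] exI[of _ M]) auto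

lemma runs_to_mono: "runs_to P T p q Q R M \<Longrightarrow> T \<le> U \<Longrightarrow> runs_to P U p q Q R M"
  unfolding runs_to_def using le_trans by blast

lemma runs_to_trans:
  assumes first: "runs_to P T p q Q R M"
    and second: "\<And>R' M'. Q R' M' \<Longrightarrow> runs_to P U q r Q' R' M'"
  shows "runs_to P (T + U) p r Q' R M"
proof -
  obtain t R\<^sub>1 M\<^sub>1 where t: "t \<le> T" "(step P ^^ t) (Config p R M) = Config q R\<^sub>1 M\<^sub>1" "Q R\<^sub>1 M\<^sub>1"
    using first by (auto simp: runs_to_def)
  obtain u R\<^sub>2 M\<^sub>2 where "u \<le> U" "(step P ^^ u) (Config q R\<^sub>1 M\<^sub>1) = Config r R\<^sub>2 M\<^sub>2" "Q' R\<^sub>2 M\<^sub>2"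
    using second[OF t(3)] by (auto simp: runs_to_def)
  moreover from this t have "(step P ^^ (u + t)) (Config p R M) = Config r R\<^sub>2 M\<^sub>2"
    by (simp add: funpow_add)
  ultimately show ?thesis
    unfolding runs_to_def using t(1) by (metis add.commute add_mono)
qed

lemma runs_to_exec:
  assumes "p < length P" "exec (P ! p) (Config p R M) = Config q R' M'" "runs_to P T q r Q R' M'"
  shows "runs_to P (Suc T) p r Q R M"
proof -
  obtain t R'' M'' where t: "t \<le> T" "(step P ^^ t) (Config q R' M') = Config r R'' M''" "Q R'' M''"
    using assms(3) by (auto simp: runs_to_def)
  have "step P (Config p R M) = Config q R' M'" using assms(1,2) by (simp add: step_def halted_def)
  then have "(step P ^^ Suc t) (Config p R M) = Config r R'' M''"
    using t(2) by (simp add: funpow_swap1)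
  then show ?thesis unfolding runs_to_def using t(1,3) by (metis Suc_le_mono)
qed

lemma runs_to_IfZ:
  assumes code: "code_at P p (compile p (IfZ r c))"
    and body: "R r = 0 \<Longrightarrow> code_at P (p + 2) (compile (p + 2) c) \<Longrightarrow>
      runs_to P T (p + 2) (p + 2 + csize c) Q R M"
    and skip: "R r \<noteq> 0 \<Longrightarrow> Q R M"
  shows "runs_to P (T + 2) p (p + csize (IfZ r c)) Q R M"
proof -
  note test = code_at_ConsD[OF code[unfolded compile.simps]]
  note jump = code_at_ConsD[OF test(3)]
  have "runs_to P (Suc (Suc T)) p (p + 2 + csize c) Q R M"
  proof (cases "R r = 0")
    case True
    then have "runs_to P T (p + 2) (p + 2 + csize c) Q R M" using body jump(3) by simp
    then have "runs_to P (Suc T) (p + 2) (p + 2 + csize c) Q R M" by (rule runs_to_mono) simp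
    then show ?thesis using True test by (auto intro: runs_to_exec)
  next
    case False
    then show ?thesis using skip test jump by (auto intro!: runs_to_exec runs_to_refl)
  qed
  then show ?thesis by (simp add: add_ac)
qed

lemma runs_to_IfNZ:
  assumes code: "code_at P p (compile p (IfNZ r c))"
    and body: "R r \<noteq> 0 \<Longrightarrow> code_at P (p + 1) (compile (p + 1) c) \<Longrightarrow>
      runs_to P T (p + 1) (p + 1 + csize c) Q R M"
    and skip: "R r = 0 \<Longrightarrow> Q R M"
  shows "runs_to P (T + 1) p (p + csize (IfNZ r c)) Q R M"
proof -
  note test = code_at_ConsD[OF code[unfolded compile.simps]]
  have "runs_to P (Suc T) p (p + 1 + csize c) Q R M"
  proof (cases "R r = 0")
    case True
    then show ?thesis using skip test by (auto intro!: runs_to_exec runs_to_refl)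
  next
    case False
    then have "runs_to P T (Suc p) (p + 1 + csize c) Q R M" using body test(3) by simp
    then show ?thesis using False test by (auto intro: runs_to_exec)
  qed
  then show ?thesis by simp
qed

lemma runs_to_While:
  assumes code: "code_at P p (compile p (While b r c))"
    and body: "\<And>Q R M. F Q R M \<Longrightarrow> code_at P (p + 1) (compile (p + 1) c) \<Longrightarrow>
      runs_to P T (p + 1) (p + 1 + csize c) Q R M"
    and iterations: "while_wp F r k Q R M"
  shows "runs_to P (k * (T + 2) + 1) p (p + csize (While b r c)) Q R M"
proof -
  note test = code_at_ConsD[OF code[unfolded compile.simps]]
  have code_body: "code_at P (p + 1) (compile (p + 1) c)"
    using test(3) by (auto dest: code_at_appendD)
  have jump: "p + 1 + csize c < length P" "P ! (p + 1 + csize c) = Jump p"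
    using code_at_ConsD[OF code_at_appendD(2)[OF test(3)]] by simp_all
  have "runs_to P (k * (T + 2) + 1) p (p + 2 + csize c) Q R M"
    using iterations
  proof (induction k arbitrary: R M)
    case 0
    then show ?case using test by (auto intro!: runs_to_exec runs_to_refl)
  next
    case (Suc k)
    have "runs_to P T (p + 1) (p + 1 + csize c) (while_wp F r k Q) R M"
      using Suc.prems code_body by (intro body) simp_all
    moreover have "runs_to P (Suc (k * (T + 2) + 1)) (p + 1 + csize c) (p + 2 + csize c) Q R' M'"
      if "while_wp F r k Q R' M'" for R' M'
      using Suc.IH[OF that] jump by (auto intro: runs_to_exec)
    ultimately have "runs_to P (T + Suc (k * (T + 2) + 1)) (p + 1) (p + 2 + csize c) Q R M"
      by (rule runs_to_trans)
    then have "runs_to P (Suc (T + Suc (k * (T + 2) + 1))) p (p + 2 + csize c) Q R M"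
      using Suc.prems test by (intro runs_to_exec) simp_all
    then show ?case by (simp add: add_ac)
  qed
  then show ?thesis by (simp add: add_ac)
qed

lemma wp_sound:
  "wp \<beta> c Q R M \<Longrightarrow> code_at P p (compile p c) \<Longrightarrow> runs_to P (cost \<beta> c) p (p + csize c) Q R M"
proof (induction c arbitrary: p Q R M)
  case (Ins i)
  note code = code_at_ConsD[OF Ins.prems(2)[unfolded compile.simps]]
  have "runs_to P (Suc 0) p (Suc p) Q R M"
    using Ins.prems(1) code by (cases i) (auto intro!: runs_to_exec runs_to_refl)
  then show ?case by simp
next
  case (Seq c d)
  have "runs_to P (cost \<beta> c) p (p + csize c) (wp \<beta> d Q) R M"
    using Seq.prems by (intro Seq.IH(1)) (auto dest: code_at_appendD)
  moreover have "code_at P (p + csize c) (compile (p + csize c) d)"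
    using Seq.prems(2) by (auto dest: code_at_appendD)
  ultimately show ?case
    using Seq.IH(2) by (auto simp: add.assoc[symmetric] intro: runs_to_trans)
next
  case (IfZ r c)
  show ?case unfolding cost.simps
    by (rule runs_to_IfZ[OF IfZ.prems(2)], rule IfZ.IH) (use IfZ.prems(1) in simp_all)
next
  case (IfNZ r c)
  show ?case unfolding cost.simps
    by (rule runs_to_IfNZ[OF IfNZ.prems(2)], rule IfNZ.IH) (use IfNZ.prems(1) in simp_all)
next
  case (While b r c)
  obtain k where k: "k \<le> \<beta> b" "while_wp (wp \<beta> c) r k Q R M"
    using While.prems(1) by auto
  have "runs_to P (k * (cost \<beta> c + 2) + 1) p (p + csize (While b r c)) Q R M"
    using While.prems(2) While.IH k(2) by (rule runs_to_While)
  then show ?case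
    using mult_le_mono1[OF k(1), of "cost \<beta> c + 2"] by (auto elim: runs_to_mono)
qed

lemma answers_within_mono: "answers_within P w b T \<Longrightarrow> T \<le> U \<Longrightarrow> answers_within P w b U"
  unfolding answers_within_def using le_trans by blast

lemma answers_within_compile:
  assumes "wp \<beta> c (\<lambda>R M. R 0 = (if b then 1 else 0)) (\<lambda>_. 0) (mem (initial w))"
  shows "answers_within (compile 0 c) w b (cost \<beta> c)"
proof -
  have "code_at (compile 0 c) 0 (compile 0 c)" by (simp add: code_at_def)
  from wp_sound[OF assms this] show ?thesis
    unfolding runs_to_def answers_within_def Let_def halted_def initial_def by fastforce
qed


subsection \<open>Rules for sequences and loops\<close>

fun target :: "instr \<Rightarrow> reg set" where
  "target (Const r k) = {r}"
| "target (Copy r s) = {r}"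
| "target (Add r s t) = {r}"
| "target (Sub r s t) = {r}"
| "target (Load r s) = {r}"
| "target i = {}"

primrec writes :: "'b com \<Rightarrow> reg set" where
  "writes (Ins i) = target i"
| "writes (c ;; d) = writes c \<union> writes d"
| "writes (IfZ r c) = writes c"
| "writes (IfNZ r c) = writes c"
| "writes (While b r c) = writes c"

definition unchanged :: "reg set \<Rightarrow> (reg \<Rightarrow> nat) \<Rightarrow> (reg \<Rightarrow> nat) \<Rightarrow> bool" where
  "unchanged S R R' \<longleftrightarrow> (\<forall>r. r \<notin> S \<longrightarrow> R' r = R r)"

lemma unchangedD: "unchanged S R R' \<Longrightarrow> r \<notin> S \<Longrightarrow> R' r = R r"
  by (simp add: unchanged_def)

lemma unchanged_refl: "unchanged S R R"
  by (simp add: unchanged_def)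

lemma unchanged_trans: "unchanged S R R' \<Longrightarrow> unchanged S R' R'' \<Longrightarrow> unchanged S R R''"
  by (simp add: unchanged_def)

lemma unchanged_mono: "unchanged S R R' \<Longrightarrow> S \<subseteq> T \<Longrightarrow> unchanged T R R'"
  by (auto simp: unchanged_def)

lemma while_wp_conseq:
  assumes "while_wp F r k Q R' M'" "unchanged S R R'"
    and exit: "\<And>R' M'. unchanged S R R' \<Longrightarrow> Q R' M' \<Longrightarrow> Q' R' M'"
    and body: "\<And>P P' R M. F P R M \<Longrightarrow>
      (\<And>R' M'. unchanged S R R' \<Longrightarrow> P R' M' \<Longrightarrow> P' R' M') \<Longrightarrow> F P' R M"
  shows "while_wp F r k Q' R' M'"
  using assms(1,2)
proof (induction k arbitrary: R' M')
  case 0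
  then show ?case using exit by simp
next
  case (Suc k)
  have "F (while_wp F r k Q) R' M'" using Suc.prems(1) by simp
  then have "F (while_wp F r k Q') R' M'"
    by (rule body) (blast intro: Suc.IH unchanged_trans[OF Suc.prems(2)])
  then show ?case using Suc.prems(1) by simp
qed

lemma wp_conseq:
  "wp \<beta> c Q R M \<Longrightarrow> (\<And>R' M'. unchanged (writes c) R R' \<Longrightarrow> Q R' M' \<Longrightarrow> Q' R' M') \<Longrightarrow> wp \<beta> c Q' R M"
proof (induction c arbitrary: Q Q' R M)
  case (Ins i)
  show ?case using Ins.prems(1) by (cases i) (auto simp: unchanged_def intro!: Ins.prems(2))
next
  case (Seq c d)
  have "wp \<beta> c (wp \<beta> d Q) R M" using Seq.prems(1) by simp
  then have "wp \<beta> c (wp \<beta> d Q') R M"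
  proof (rule Seq.IH(1))
    fix R\<^sub>1 M\<^sub>1 assume c: "unchanged (writes c) R R\<^sub>1" and "wp \<beta> d Q R\<^sub>1 M\<^sub>1"
    from this(2) show "wp \<beta> d Q' R\<^sub>1 M\<^sub>1"
    proof (rule Seq.IH(2))
      fix R\<^sub>2 M\<^sub>2 assume d: "unchanged (writes d) R\<^sub>1 R\<^sub>2" and "Q R\<^sub>2 M\<^sub>2"
      from unchanged_trans[OF unchanged_mono[OF c] unchanged_mono[OF d]] this(2)
      show "Q' R\<^sub>2 M\<^sub>2" by (intro Seq.prems(2)) auto
    qed
  qed
  then show ?case by simp
next
  case (While b r c)
  obtain k where "k \<le> \<beta> b" and iterations: "while_wp (wp \<beta> c) r k Q R M"
    using While.prems(1) by auto
  moreover from iterations unchanged_refl have "while_wp (wp \<beta> c) r k Q' R M"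
    by (rule while_wp_conseq) (use While.prems(2) in auto, blast intro: While.IH)
  ultimately show ?case by auto
qed (auto simp: unchanged_refl)

lemma wp_SeqI:
  assumes "wp \<beta> c P R M" "\<And>R' M'. unchanged (writes c) R R' \<Longrightarrow> P R' M' \<Longrightarrow> wp \<beta> d Q R' M'"
  shows "wp \<beta> (c ;; d) Q R M"
  using wp_conseq[OF assms] by simp

lemma wp_WhileI:
  assumes bound: "N \<le> \<beta> b" and start: "I 0 R M"
    and body: "\<And>k R M. k < N \<Longrightarrow> I k R M \<Longrightarrow> R r \<noteq> 0 \<and> wp \<beta> c (I (Suc k)) R M"
    and exit: "\<And>R M. I N R M \<Longrightarrow> R r = 0 \<and> Q R M"
  shows "wp \<beta> (While b r c) Q R M"
proof -
  have "while_wp (wp \<beta> c) r j Q R M" if "j \<le> N" "I (N - j) R M" for j R M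
    using that
  proof (induction j arbitrary: R M)
    case 0
    then show ?case using exit by simp
  next
    case (Suc j)
    then have "R r \<noteq> 0" "wp \<beta> c (I (N - j)) R M"
      using body[of "N - Suc j" R M] by (simp_all add: Suc_diff_Suc)
    moreover from this(2) have "wp \<beta> c (while_wp (wp \<beta> c) r j Q) R M"
      by (rule wp_conseq) (use Suc in auto)
    ultimately show ?case by simp
  qed
  from this[of N R M] show ?thesis using bound start by auto
qed


section \<open>Induced paths and cycles\<close>

definition adj :: "'a set set \<Rightarrow> ('a \<times> 'a) set" where
  "adj E = {(u, v). {u, v} \<in> E}"

lemma in_adj_iff [simp]: "(u, v) \<in> adj E \<longleftrightarrow> {u, v} \<in> E"
  by (simp add: adj_def)

lemma sym_adj: "sym (adj E)"
  by (auto simp: sym_def insert_commute)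

lemma sym_Restr: "sym r \<Longrightarrow> sym (Restr r W)"
  by (auto simp: sym_def)

lemma ugraph_edgeD:
  assumes "ugraph V E" "{u, v} \<in> E"
  shows "u \<in> V" "v \<in> V" "u \<noteq> v"
  using assms by (auto simp: ugraph_def)

lemma singleton_notin_ugraph: "ugraph V E \<Longrightarrow> {v} \<notin> E"
  by (auto simp: ugraph_def)

lemma induced_path_nth_edge_iff:
  assumes "induced_path V E p" "i < length p" "j < length p"
  shows "{p ! i, p ! j} \<in> E \<longleftrightarrow> j = Suc i \<or> i = Suc j"
  using assms unfolding induced_path_def by blast

lemma induced_cycle_nth_edge_iff:
  assumes "induced_cycle V E c" "i < length c" "j < length c"
  shows "{c ! i, c ! j} \<in> E \<longleftrightarrow> j = Suc i mod length c \<or> i = Suc j mod length c"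
  using assms unfolding induced_cycle_def by blast

lemma induced_path_singleton: "ugraph V E \<Longrightarrow> induced_path V E [v] \<longleftrightarrow> v \<in> V"
  by (simp add: induced_path_def singleton_notin_ugraph)

lemma ball_set_eq_hd_iff:
  assumes "distinct p"
  shows "(\<forall>v\<in>set p. Q v \<longleftrightarrow> v = hd p) \<longleftrightarrow> (\<forall>i<length p. Q (p ! i) \<longleftrightarrow> i = 0)"
proof -
  have "p ! i = hd p \<longleftrightarrow> i = 0" if "i < length p" for i
    using that nth_eq_iff_index_eq[OF assms, of i 0] by (cases p) auto
  then show ?thesis by (auto simp: all_set_conv_all_nth)
qed

lemma ball_set_eq_last_iff:
  assumes "distinct p"
  shows "(\<forall>v\<in>set p. Q v \<longleftrightarrow> v = last p) \<longleftrightarrow> (\<forall>i<length p. Q (p ! i) \<longleftrightarrow> Suc i = length p)"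
proof -
  have "p ! i = last p \<longleftrightarrow> Suc i = length p" if "i < length p" for i
  proof -
    have "last p = p ! (length p - 1)" using that by (intro last_conv_nth) auto
    then show ?thesis using that nth_eq_iff_index_eq[OF assms, of i "length p - 1"] by auto
  qed
  then show ?thesis by (auto simp: all_set_conv_all_nth)
qed

lemma induced_path_Cons_iff:
  assumes g: "ugraph V E" and "p \<noteq> []"
  shows "induced_path V E (v # p) \<longleftrightarrow> induced_path V E p \<and> v \<in> V \<and> v \<notin> set p \<and>
    (\<forall>u\<in>set p. {v, u} \<in> E \<longleftrightarrow> u = hd p)"
  using assms(2) ball_set_eq_hd_iff[of p "\<lambda>u. {v, u} \<in> E"] singleton_notin_ugraph[OF g]
  by (auto simp: induced_path_def All_less_Suc2 insert_commute)

lemma induced_path_appendD: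
  assumes "induced_path V E (p @ q @ r)" "q \<noteq> []"
  shows "induced_path V E q"
proof -
  have "{q ! i, q ! j} \<in> E \<longleftrightarrow> j = Suc i \<or> i = Suc j" if "i < length q" "j < length q" for i j
  proof -
    have "{(p @ q @ r) ! (length p + i), (p @ q @ r) ! (length p + j)} \<in> E \<longleftrightarrow>
        length p + j = Suc (length p + i) \<or> length p + i = Suc (length p + j)"
      using that by (intro induced_path_nth_edge_iff[OF assms(1)]) auto
    then show ?thesis using that by (simp add: nth_append)
  qed
  then show ?thesis using assms by (simp add: induced_path_def)
qed

lemma induced_path_imp_rtrancl:
  assumes "ugraph V E"
  shows "induced_path V E p \<Longrightarrow> set p \<subseteq> W \<Longrightarrow> (hd p, last p) \<in> (Restr (adj E) W)\<^sup>*"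
proof (induction p)
  case (Cons v p)
  show ?case
  proof (cases "p = []")
    case False
    then have "induced_path V E p" "{v, hd p} \<in> E"
      using Cons.prems(1) assms by (simp_all add: induced_path_Cons_iff)
    moreover have "hd p \<in> W" using False Cons.prems(2) by auto
    ultimately have "(v, hd p) \<in> Restr (adj E) W" "(hd p, last p) \<in> (Restr (adj E) W)\<^sup>*"
      using Cons by auto
    then show ?thesis using False by (auto intro: converse_rtrancl_into_rtrancl)
  qed simp
qed (simp add: induced_path_def)

lemma rtrancl_imp_induced_path:
  assumes g: "ugraph V E" and "(a, b) \<in> (Restr (adj E) W)\<^sup>*" "b \<in> V" "b \<in> W"
  obtains p where "induced_path V E p" "hd p = a" "last p = b" "set p \<subseteq> W"
proof -
  from assms(2) have "\<exists>p. induced_path V E p \<and> hd p = a \<and> last p = b \<and> set p \<subseteq> W"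
  proof (induction rule: converse_rtrancl_induct)
    case base
    show ?case using assms by (intro exI[of _ "[b]"]) (simp add: induced_path_singleton)
  next
    case (step a a')
    then obtain p where p: "induced_path V E p" "hd p = a'" "last p = b" "set p \<subseteq> W" by blast
    then have "a' \<in> set p" by (auto simp: induced_path_def)
    moreover have "{a, a'} \<in> E" "a \<in> W" using step.hyps by auto
    ultimately obtain q v r where r: "p = q @ v # r" "v = a \<or> {a, v} \<in> E"
      "\<forall>u\<in>set r. \<not> (u = a \<or> {a, u} \<in> E)"
      using split_list_last_prop[of p "\<lambda>v. v = a \<or> {a, v} \<in> E"] by blast
    have vr: "induced_path V E (v # r)"
      using p(1) induced_path_appendD[of V E q "v # r" "[]"] r(1) by simp
    show ?case
    proof (cases "v = a")
      case True
      then show ?thesis using vr p r(1) by (intro exI[of _ "v # r"]) auto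
    next
      case False
      have "v \<notin> set r" using vr by (simp add: induced_path_def)
      then have "induced_path V E (a # v # r)"
        using vr r False ugraph_edgeD(1)[OF g] by (auto simp: induced_path_Cons_iff[OF g])
      then show ?thesis
        using p r(1) \<open>a \<in> W\<close> by (intro exI[of _ "a # v # r"]) auto
    qed
  qed
  then show thesis using that by blast
qed

lemma induced_cycle_rotate1:
  assumes "induced_cycle V E c"
  shows "induced_cycle V E (rotate1 c)"
proof -
  let ?n = "length c"
  have n: "3 \<le> ?n" using assms by (simp add: induced_cycle_def)
  have "{rotate1 c ! i, rotate1 c ! j} \<in> E \<longleftrightarrow> j = Suc i mod ?n \<or> i = Suc j mod ?n"
    if "i < ?n" "j < ?n" for i j
  proof -
    have "{c ! (Suc i mod ?n), c ! (Suc j mod ?n)} \<in> E \<longleftrightarrow>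
        Suc j mod ?n = Suc (Suc i mod ?n) mod ?n \<or> Suc i mod ?n = Suc (Suc j mod ?n) mod ?n"
      using n by (intro induced_cycle_nth_edge_iff[OF assms] mod_less_divisor) auto
    moreover have "Suc l mod ?n = Suc (Suc k mod ?n) mod ?n \<longleftrightarrow> l = Suc k mod ?n"
      if "k < ?n" "l < ?n" for k l
      using that n by (auto simp: mod_Suc split: if_splits)
    ultimately show ?thesis using that by (simp add: nth_rotate1)
  qed
  then show ?thesis using assms by (simp add: induced_cycle_def)
qed

lemma induced_cycle_append_commute:
  assumes "induced_cycle V E (p @ q)"
  shows "induced_cycle V E (q @ p)"
proof -
  have "induced_cycle V E (rotate k (p @ q))" for k
    using assms by (induction k) (simp_all add: induced_cycle_rotate1)
  from this[of "length p"] show ?thesis by (simp add: rotate_append)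
qed

lemma all_less_Suc_Suc_sym_iff:
  assumes "\<And>i j. Q i j \<longleftrightarrow> Q j i"
  shows "(\<forall>i<Suc (Suc n). \<forall>j<Suc (Suc n). Q i j) \<longleftrightarrow> Q 0 0 \<and> Q 0 (Suc 0) \<and> Q (Suc 0) (Suc 0) \<and>
    (\<forall>i<n. Q (Suc 0) (Suc (Suc i))) \<and> (\<forall>i<n. Q 0 (Suc (Suc i))) \<and>
    (\<forall>i<n. \<forall>j<n. Q (Suc (Suc i)) (Suc (Suc j)))"
  using assms by (auto simp: All_less_Suc2)

lemma induced_cycle_Cons_Cons_nth_iff:
  assumes g: "ugraph V E" and "p \<noteq> []"
  shows "induced_cycle V E (y # x # p) \<longleftrightarrow> {x, y} \<in> E \<and> induced_path V E p \<and> x \<notin> set p \<and> y \<notin> set p \<and>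
    (\<forall>i<length p. {x, p ! i} \<in> E \<longleftrightarrow> i = 0) \<and> (\<forall>i<length p. {y, p ! i} \<in> E \<longleftrightarrow> Suc i = length p)"
proof -
  obtain n where n: "length p = Suc n" using assms(2) by (cases p) auto
  define c where "c = y # x # p"
  have [simp]: "c ! 0 = y" "c ! Suc 0 = x" "c ! Suc (Suc i) = p ! i"
    "length c = Suc (Suc (Suc n))" for i
    by (simp_all add: c_def n)
  define Q where "Q i j \<longleftrightarrow> ({c ! i, c ! j} \<in> E \<longleftrightarrow>
    j = Suc i mod length c \<or> i = Suc j mod length c)" for i j
  have Q_sym: "Q i j \<longleftrightarrow> Q j i" for i j
    by (auto simp: Q_def insert_commute)
  have Q_xy: "Q 0 0" "Q (Suc 0) (Suc 0)" "Q 0 (Suc 0) \<longleftrightarrow> {x, y} \<in> E"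
    by (auto simp: Q_def singleton_notin_ugraph[OF g] insert_commute)
  have Q_p: "Q (Suc 0) (Suc (Suc i)) \<longleftrightarrow> ({x, p ! i} \<in> E \<longleftrightarrow> i = 0)"
    "Q 0 (Suc (Suc i)) \<longleftrightarrow> ({y, p ! i} \<in> E \<longleftrightarrow> i = n)"
    "j < Suc n \<Longrightarrow> Q (Suc (Suc i)) (Suc (Suc j)) \<longleftrightarrow> ({p ! i, p ! j} \<in> E \<longleftrightarrow> j = Suc i \<or> i = Suc j)"
    if "i < Suc n" for i j
    using that by (auto simp: Q_def mod_Suc)
  have "induced_cycle V E c \<longleftrightarrow> distinct c \<and> set c \<subseteq> V \<and> (\<forall>i<length c. \<forall>j<length c. Q i j)"
    by (simp add: induced_cycle_def Q_def)
  also have "\<dots> \<longleftrightarrow> distinct c \<and> set c \<subseteq> V \<and> {x, y} \<in> E \<and>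
      (\<forall>i<Suc n. {x, p ! i} \<in> E \<longleftrightarrow> i = 0) \<and> (\<forall>i<Suc n. {y, p ! i} \<in> E \<longleftrightarrow> i = n) \<and>
      (\<forall>i<Suc n. \<forall>j<Suc n. {p ! i, p ! j} \<in> E \<longleftrightarrow> j = Suc i \<or> i = Suc j)"
    by (simp add: all_less_Suc_Suc_sym_iff[OF Q_sym] Q_xy Q_p)
  finally show ?thesis
    using ugraph_edgeD[OF g, of x y] assms(2) by (auto simp: induced_path_def n c_def)
qed

lemma induced_cycle_Cons_Cons_iff:
  assumes "ugraph V E" "p \<noteq> []"
  shows "induced_cycle V E (y # x # p) \<longleftrightarrow> {x, y} \<in> E \<and> induced_path V E p \<and> x \<notin> set p \<and> y \<notin> set p \<and>
    (\<forall>v\<in>set p. {x, v} \<in> E \<longleftrightarrow> v = hd p) \<and> (\<forall>v\<in>set p. {y, v} \<in> E \<longleftrightarrow> v = last p)"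
proof (cases "distinct p")
  case True
  then show ?thesis
    by (simp only: induced_cycle_Cons_Cons_nth_iff[OF assms] ball_set_eq_hd_iff ball_set_eq_last_iff)
next
  case False
  then show ?thesis by (simp add: induced_cycle_def induced_path_def)
qed

lemma induced_cycle_through_edgeE:
  assumes c: "induced_cycle V E c" and xy: "x \<in> set c" "y \<in> set c" "{x, y} \<in> E" and g: "ugraph V E"
  obtains p where "induced_cycle V E (x # y # p) \<or> induced_cycle V E (y # x # p)"
    "set c = insert x (insert y (set p))" "p \<noteq> []"
proof -
  obtain q r where "c = q @ x # r" using split_list[OF xy(1)] by blast
  define d where "d = r @ q"
  have d: "induced_cycle V E (x # d)" "set c = insert x (set d)"
    using c induced_cycle_append_commute[of V E q "x # r"] \<open>c = q @ x # r\<close> by (auto simp: d_def)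
  have len: "2 \<le> length d" using d(1) by (simp add: induced_cycle_def)
  have "y \<in> set d" using xy d(2) ugraph_edgeD[OF g xy(3)] by auto
  then obtain j where j: "j < length d" "d ! j = y" by (auto simp: in_set_conv_nth)
  have "{(x # d) ! 0, (x # d) ! Suc j} \<in> E" using j xy(3) by simp
  then have "Suc j = 1 mod Suc (length d) \<or> 0 = Suc (Suc j) mod Suc (length d)"
    using induced_cycle_nth_edge_iff[OF d(1), of 0 "Suc j"] j(1) by simp
  then consider (successor) "j = 0" | (predecessor) "Suc j = length d" using j(1) len by (auto simp: mod_Suc split: if_splits)
  then show thesis
  proof cases
    case successor
    then obtain p where "d = y # p" using j by (cases d) auto
    then show ?thesis using d len by (intro that[of p]) auto
  next
    case predecessor
    then obtain p where p: "d = p @ [y]" using j by (cases d rule: rev_cases) auto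
    then have "induced_cycle V E (y # x # p)"
      using induced_cycle_append_commute[of V E "x # p" "[y]"] d(1) by simp
    then show ?thesis using d(2) len p by (intro that[of p]) auto
  qed
qed


section \<open>Avoidable edges\<close>

definition closed_nbhd :: "'a set set \<Rightarrow> 'a \<Rightarrow> 'a set" where
  "closed_nbhd E x = insert x (adj E `` {x})"

definition outside :: "'a set set \<Rightarrow> 'a \<Rightarrow> 'a \<Rightarrow> 'a set" where
  "outside E x y = - (closed_nbhd E x \<union> closed_nbhd E y)"

lemma outside_commute: "outside E x y = outside E y x"
  by (simp add: outside_def Un_commute)

definition linked_through :: "'a set set \<Rightarrow> 'a set \<Rightarrow> 'a \<Rightarrow> 'a \<Rightarrow> bool" where
  "linked_through E W a b \<longleftrightarrow> (\<exists>u\<in>W. \<exists>v\<in>W.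
     {a, u} \<in> E \<and> (u, v) \<in> (Restr (adj E) W)\<^sup>* \<and> {v, b} \<in> E)"

lemma linked_through_sym:
  assumes "linked_through E W a b"
  shows "linked_through E W b a"
proof -
  obtain u v where uv: "u \<in> W" "v \<in> W" "{a, u} \<in> E" "(u, v) \<in> (Restr (adj E) W)\<^sup>*" "{v, b} \<in> E"
    using assms by (auto simp: linked_through_def)
  moreover from uv(4) have "(v, u) \<in> (Restr (adj E) W)\<^sup>*"
    by (rule symD[OF sym_rtrancl[OF sym_Restr[OF sym_adj]]])
  moreover have "{b, v} \<in> E" "{u, a} \<in> E" using uv by (simp_all add: insert_commute)
  ultimately show ?thesis unfolding linked_through_def by blast
qed

lemma P4_iff:
  assumes "ugraph V E"
  shows "P4 V E [a, x, y, b] \<longleftrightarrow> {x, y} \<in> E \<and>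
    a \<in> closed_nbhd E x - closed_nbhd E y \<and> b \<in> closed_nbhd E y - closed_nbhd E x \<and> {a, b} \<notin> E"
  using ugraph_edgeD[OF assms]
  by (auto simp: P4_def closed_nbhd_def induced_path_Cons_iff[OF assms] induced_path_singleton[OF assms]
      insert_commute)

lemma P4_rev: "ugraph V E \<Longrightarrow> P4 V E [a, x, y, b] \<Longrightarrow> P4 V E [b, y, x, a]"
  by (auto simp: P4_iff insert_commute)

lemma linked_through_if_induced_cycle:
  assumes g: "ugraph V E" and P: "P4 V E [a, x, y, b]"
    and c: "induced_cycle V E (y # x # p)" "p \<noteq> []" "a \<in> set p" "b \<in> set p"
  shows "linked_through E (outside E x y) a b"
proof -
  have ab: "{x, a} \<in> E" "{y, b} \<in> E" "{a, b} \<notin> E" "a \<noteq> b"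
    using P[unfolded P4_iff[OF g]] c by (auto simp: closed_nbhd_def induced_cycle_def)
  note cycle = c(1)[unfolded induced_cycle_Cons_Cons_iff[OF g c(2)]]
  then have ends: "a = hd p" "b = last p" using c(3,4) ab by blast+
  then obtain p' where p': "p = a # p'" using c(2) by (cases p) auto
  have "p' \<noteq> []" using ends ab(4) unfolding p' by auto
  then have "p' = butlast p' @ [b]" using ends(2) unfolding p' by simp
  then obtain q where q: "p = a # q @ [b]" using p' by blast
  have path: "induced_path V E (a # q @ [b])" using cycle q by simp
  then have "q \<noteq> []" using ab by (auto simp: induced_path_Cons_iff[OF g])
  then obtain r v where v: "q = r @ [v]" by (cases q rule: rev_cases) auto
  have "{a, hd q} \<in> E"
    using path \<open>q \<noteq> []\<close> by (simp add: induced_path_Cons_iff[OF g])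
  moreover have "{v, b} \<in> E"
    using induced_path_appendD[of V E "a # r" "[v, b]" "[]"] path v
    by (simp add: induced_path_Cons_iff[OF g])
  moreover have outside: "set q \<subseteq> outside E x y"
    using cycle path q by (auto simp: outside_def closed_nbhd_def induced_path_def)
  moreover have "(hd q, last q) \<in> (Restr (adj E) (outside E x y))\<^sup>*"
    using induced_path_appendD[of V E "[a]" q "[b]"] path \<open>q \<noteq> []\<close> outside
    by (intro induced_path_imp_rtrancl[OF g]) simp_all
  ultimately show ?thesis
    unfolding linked_through_def using v hd_in_set[OF \<open>q \<noteq> []\<close>]
    by (intro bexI[of _ "hd q"] bexI[of _ v]) auto
qed

lemma induced_cycle_if_linked_through:
  assumes g: "ugraph V E" and P: "P4 V E [a, x, y, b]"
    and "linked_through E (outside E x y) a b"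
  obtains p where "induced_cycle V E (y # x # p)" "a \<in> set p" "b \<in> set p"
proof -
  let ?W = "outside E x y" and ?S = "insert a (insert b (outside E x y))"
  obtain u v where uv: "u \<in> ?W" "v \<in> ?W" "{a, u} \<in> E" "(u, v) \<in> (Restr (adj E) ?W)\<^sup>*" "{v, b} \<in> E"
    using assms(3) by (auto simp: linked_through_def)
  have "(Restr (adj E) ?W)\<^sup>* \<subseteq> (Restr (adj E) ?S)\<^sup>*" by (rule rtrancl_mono) auto
  then have "(u, v) \<in> (Restr (adj E) ?S)\<^sup>*" using uv(4) by blast
  moreover have "(a, u) \<in> Restr (adj E) ?S" "(v, b) \<in> Restr (adj E) ?S" using uv by auto
  ultimately have "(a, b) \<in> (Restr (adj E) ?S)\<^sup>*"
    by (meson converse_rtrancl_into_rtrancl rtrancl.rtrancl_into_rtrancl)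
  moreover have "b \<in> V" using ugraph_edgeD[OF g uv(5)] by simp
  ultimately obtain p where p: "induced_path V E p" "hd p = a" "last p = b" "set p \<subseteq> ?S"
    using rtrancl_imp_induced_path[OF g, of a b ?S] by blast
  have "p \<noteq> []" using p(1) by (simp add: induced_path_def)
  have "{x, w} \<in> E \<longleftrightarrow> w = a" "{y, w} \<in> E \<longleftrightarrow> w = b" "w \<noteq> x" "w \<noteq> y" if "w \<in> set p" for w
    using that p(4) P[unfolded P4_iff[OF g]]
    by (auto simp: outside_def closed_nbhd_def insert_commute)
  then have "induced_cycle V E (y # x # p)"
    using p P[unfolded P4_iff[OF g]] by (auto simp: induced_cycle_Cons_Cons_iff[OF g \<open>p \<noteq> []\<close>])
  then show thesis using that p \<open>p \<noteq> []\<close> hd_in_set last_in_set by metis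
qed

lemma P4_in_induced_cycle_iff:
  assumes g: "ugraph V E" and P: "P4 V E [a, x, y, b]"
  shows "(\<exists>c. induced_cycle V E c \<and> set [a, x, y, b] \<subseteq> set c) \<longleftrightarrow> linked_through E (outside E x y) a b"
    (is "?L \<longleftrightarrow> ?R")
proof
  assume ?L
  then obtain c where c: "induced_cycle V E c" "set [a, x, y, b] \<subseteq> set c" by blast
  have xy: "{x, y} \<in> E" using P by (simp add: P4_iff[OF g])
  from c obtain p where p: "induced_cycle V E (x # y # p) \<or> induced_cycle V E (y # x # p)"
    "set c = insert x (insert y (set p))" "p \<noteq> []"
    using induced_cycle_through_edgeE[OF c(1) _ _ xy g] by auto
  moreover have "distinct [a, x, y, b]" using P by (simp add: P4_def induced_path_def)
  ultimately have "a \<in> set p" "b \<in> set p" using c(2) by auto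
  with p linked_through_if_induced_cycle[OF g P]
    linked_through_if_induced_cycle[OF g P4_rev[OF g P]]
  show ?R by (auto simp: outside_commute intro: linked_through_sym)
next
  assume ?R
  then obtain p where "induced_cycle V E (y # x # p)" "a \<in> set p" "b \<in> set p"
    using induced_cycle_if_linked_through[OF g P] by blast
  then show ?L by (intro exI[of _ "y # x # p"]) simp
qed

lemma P4_middle_edgeE:
  assumes g: "ugraph V E" and "P4 V E p" "middle_edge p = {x, y}"
  obtains a b where "P4 V E [a, x, y, b]" "set p = set [a, x, y, b]"
proof -
  have "length p = Suc (Suc (Suc (Suc 0)))" using assms(2) by (simp add: P4_def)
  then obtain a u v b where p: "p = [a, u, v, b]"
    by (auto simp only: length_Suc_conv length_0_conv)
  then consider (forward) "u = x" "v = y" | (backward) "u = y" "v = x"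
    using assms(3) by (auto simp: middle_edge_def doubleton_eq_iff)
  then show thesis
  proof cases
    case forward
    then show ?thesis using p assms(2) that[of a b] by simp
  next
    case backward
    then show ?thesis using p assms(2) that[of b a] P4_rev[OF g, of a y x b] by auto
  qed
qed

lemma avoidable_edge_iff:
  assumes g: "ugraph V E" and xy: "{x, y} \<in> E"
  shows "avoidable_edge V E {x, y} \<longleftrightarrow>
    (\<forall>a \<in> closed_nbhd E x - closed_nbhd E y. \<forall>b \<in> closed_nbhd E y - closed_nbhd E x.
       {a, b} \<in> E \<or> linked_through E (outside E x y) a b)"
proof -
  let ?C = "\<lambda>p. \<exists>c. induced_cycle V E c \<and> set p \<subseteq> set c"
  have "avoidable_edge V E {x, y} \<longleftrightarrow> (\<forall>p. P4 V E p \<and> middle_edge p = {x, y} \<longrightarrow> ?C p)"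
    using xy by (auto simp: avoidable_edge_def simplicial_edge_def)
  also have "\<dots> \<longleftrightarrow> (\<forall>a b. P4 V E [a, x, y, b] \<longrightarrow> ?C [a, x, y, b])"
  proof (intro iffI allI impI)
    fix a b assume "\<forall>p. P4 V E p \<and> middle_edge p = {x, y} \<longrightarrow> ?C p" "P4 V E [a, x, y, b]"
    moreover have "middle_edge [a, x, y, b] = {x, y}" by (simp add: middle_edge_def)
    ultimately show "?C [a, x, y, b]" by blast
  next
    fix p assume "\<forall>a b. P4 V E [a, x, y, b] \<longrightarrow> ?C [a, x, y, b]" "P4 V E p \<and> middle_edge p = {x, y}"
    then show "?C p" using P4_middle_edgeE[OF g] by metis
  qed
  also have "\<dots> \<longleftrightarrow> (\<forall>a b. P4 V E [a, x, y, b] \<longrightarrow> linked_through E (outside E x y) a b)"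
    using P4_in_induced_cycle_iff[OF g] by meson
  also have "\<dots> \<longleftrightarrow> (\<forall>a \<in> closed_nbhd E x - closed_nbhd E y. \<forall>b \<in> closed_nbhd E y - closed_nbhd E x.
       {a, b} \<in> E \<or> linked_through E (outside E x y) a b)"
    unfolding P4_iff[OF g] using xy by blast
  finally show ?thesis .
qed


section \<open>Component labels\<close>

definition relabel :: "'b \<Rightarrow> 'b \<Rightarrow> ('a \<Rightarrow> 'b) \<Rightarrow> 'a \<Rightarrow> 'b" where
  "relabel c d L = (\<lambda>v. if L v = c then d else L v)"

lemma relabel_eq_iff:
  assumes L: "\<And>p q. L p = L q \<longleftrightarrow> (p, q) \<in> S\<^sup>*"
  shows "relabel (L u) (L v) L p = relabel (L u) (L v) L q \<longleftrightarrow> (p, q) \<in> (insert (u, v) (insert (v, u) S))\<^sup>*"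
    (is "?L p = ?L q \<longleftrightarrow> _ \<in> ?S\<^sup>*")
proof
  have mono: "(p, q) \<in> ?S\<^sup>*" if "L p = L q" for p q
    using that rtrancl_mono[of S ?S] unfolding L by blast
  have uv: "(u, v) \<in> ?S\<^sup>*" "(v, u) \<in> ?S\<^sup>*" by auto
  assume "?L p = ?L q"
  then consider "L p = L q" | "L p = L u" "L v = L q" | "L p = L v" "L u = L q"
    by (auto simp: relabel_def split: if_splits)
  then show "(p, q) \<in> ?S\<^sup>*"
    using mono uv by cases (blast intro: rtrancl_trans)+
next
  have step: "?L p = ?L q" if "(p, q) \<in> ?S" for p q
  proof -
    have "L p = L q \<or> {L p, L q} = {L u, L v}" using that L[of p q] by auto
    then show ?thesis by (auto simp: relabel_def doubleton_eq_iff)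
  qed
  assume "(p, q) \<in> ?S\<^sup>*"
  then show "?L p = ?L q" by induction (use step in metis)+
qed


section \<open>The program\<close>

datatype bound = Vertices | Edges

text \<open>Registers \<open>r_nbhd_x\<close> to \<open>r_vertex_mark\<close> hold the base addresses of five arrays of length \<open>n\<close>
  placed one after another behind the edge list, so that \<open>r_nbhd_x\<close> is also the end of that list.
  The verdict is kept in memory cell 0, which holds \<open>n\<close> on input; thus the loop invariants are
  predicates of the memory alone. Register 1 is avoided because the simplifier rewrites \<open>1\<close> to
  \<open>Suc 0\<close>.\<close>

abbreviation (input) r_ans :: reg where "r_ans \<equiv> 0"
abbreviation (input) r_one :: reg where "r_one \<equiv> 2"
abbreviation (input) r_n :: reg where "r_n \<equiv> 3"
abbreviation (input) r_x :: reg where "r_x \<equiv> 4"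
abbreviation (input) r_y :: reg where "r_y \<equiv> 5"
abbreviation (input) r_nbhd_x :: reg where "r_nbhd_x \<equiv> 6"
abbreviation (input) r_nbhd_y :: reg where "r_nbhd_y \<equiv> 7"
abbreviation (input) r_label :: reg where "r_label \<equiv> 8"
abbreviation (input) r_label_mark :: reg where "r_label_mark \<equiv> 9"
abbreviation (input) r_vertex_mark :: reg where "r_vertex_mark \<equiv> 10"
abbreviation (input) r_vertex :: reg where "r_vertex \<equiv> 11"
abbreviation (input) r_src :: reg where "r_src \<equiv> 12"
abbreviation (input) r_dst :: reg where "r_dst \<equiv> 13"
abbreviation (input) r_pos :: reg where "r_pos \<equiv> 14"
abbreviation (input) r_edges_left :: reg where "r_edges_left \<equiv> 15"
abbreviation (input) r_vertices_left :: reg where "r_vertices_left \<equiv> 16"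
abbreviation (input) r_tmp :: reg where "r_tmp \<equiv> 17"
abbreviation (input) r_adr :: reg where "r_adr \<equiv> 18"
abbreviation (input) r_aux :: reg where "r_aux \<equiv> 19"
abbreviation (input) r_old :: reg where "r_old \<equiv> 20"
abbreviation (input) r_new :: reg where "r_new \<equiv> 21"
abbreviation (input) r_stamp :: reg where "r_stamp \<equiv> 22"

definition load_from :: "nat \<Rightarrow> reg \<Rightarrow> 'b com" where
  "load_from i r = Ins (Const r_adr i) ;; Ins (Load r r_adr)"

definition fetch :: "reg \<Rightarrow> reg \<Rightarrow> reg \<Rightarrow> 'b com" where
  "fetch r b i = Ins (Add r_adr b i) ;; Ins (Load r r_adr)"

definition put :: "reg \<Rightarrow> reg \<Rightarrow> reg \<Rightarrow> 'b com" where
  "put b i r = Ins (Add r_adr b i) ;; Ins (Store r_adr r)"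

text \<open>A test leaves 0 in \<open>r_tmp\<close> iff it succeeds.\<close>

definition test_eq :: "reg \<Rightarrow> reg \<Rightarrow> 'b com" where
  "test_eq r s = Ins (Sub r_aux r s) ;; Ins (Sub r_tmp s r) ;; Ins (Add r_tmp r_tmp r_aux)"

definition load_edge :: "'b com" where
  "load_edge = Ins (Load r_src r_pos) ;; Ins (Add r_pos r_pos r_one) ;;
     Ins (Load r_dst r_pos) ;; Ins (Add r_pos r_pos r_one)"

definition swap_ends :: "'b com" where
  "swap_ends = Ins (Copy r_tmp r_src) ;; Ins (Copy r_src r_dst) ;; Ins (Copy r_dst r_tmp)"

definition edge_loop :: "bound com \<Rightarrow> bound com" where
  "edge_loop c = Ins (Const r_pos 4) ;; Ins (Sub r_edges_left r_nbhd_x r_pos) ;;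
     While Edges r_edges_left
       (load_edge ;; (c ;; swap_ends ;; c) ;; Ins (Sub r_edges_left r_nbhd_x r_pos))"

definition vertex_loop :: "bound com \<Rightarrow> bound com" where
  "vertex_loop c = Ins (Const r_vertex 0) ;; Ins (Sub r_vertices_left r_n r_vertex) ;;
     While Vertices r_vertices_left (
       c ;; Ins (Add r_vertex r_vertex r_one) ;; Ins (Sub r_vertices_left r_n r_vertex))"

definition load_input :: "bound com" where
  "load_input = Ins (Const r_one 1) ;;
     load_from 0 r_n ;; load_from 1 r_tmp ;; load_from 2 r_x ;; load_from 3 r_y ;;
     Ins (Const r_nbhd_x 4) ;; Ins (Add r_nbhd_x r_nbhd_x r_tmp) ;; Ins (Add r_nbhd_x r_nbhd_x r_tmp) ;;
     Ins (Add r_nbhd_y r_nbhd_x r_n) ;; Ins (Add r_label r_nbhd_y r_n) ;;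
     Ins (Add r_label_mark r_label r_n) ;; Ins (Add r_vertex_mark r_label_mark r_n)"

definition init_memory :: "bound com" where
  "init_memory = (Ins (Const r_adr 0) ;; Ins (Store r_adr r_one)) ;;
     put r_nbhd_x r_x r_one ;; put r_nbhd_y r_y r_one"

definition nbhd_body :: "bound com" where
  "nbhd_body = test_eq r_src r_x ;; IfZ r_tmp (put r_nbhd_x r_dst r_one) ;;
     test_eq r_src r_y ;; IfZ r_tmp (put r_nbhd_y r_dst r_one)"

definition init_body :: "bound com" where
  "init_body = put r_label r_vertex r_vertex"

definition relabel_body :: "bound com" where
  "relabel_body = fetch r_tmp r_label r_vertex ;; test_eq r_tmp r_old ;;
     IfZ r_tmp (put r_label r_vertex r_new)"

definition test_outside :: "reg \<Rightarrow> bound com" where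
  "test_outside r = fetch r_tmp r_nbhd_x r ;; fetch r_aux r_nbhd_y r ;; Ins (Add r_tmp r_tmp r_aux)"

definition merge_body :: "bound com" where
  "merge_body = test_outside r_src ;; IfZ r_tmp (test_outside r_dst ;; IfZ r_tmp (
     (fetch r_old r_label r_src ;; fetch r_new r_label r_dst) ;; vertex_loop relabel_body))"

text \<open>In round \<open>a\<close> the stamp is \<open>a + 1\<close>: marks of earlier rounds are smaller and need not be cleared,
  which would cost \<open>n\<close> steps per array and round.\<close>

definition mark_nbrs_body :: "bound com" where
  "mark_nbrs_body = test_eq r_src r_vertex ;; IfZ r_tmp (
     put r_vertex_mark r_dst r_stamp ;;
     fetch r_tmp r_label r_dst ;; put r_label_mark r_tmp r_stamp)"

definition mark_ends_body :: "bound com" where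
  "mark_ends_body = test_outside r_src ;; IfZ r_tmp (
     fetch r_tmp r_label r_src ;; fetch r_tmp r_label_mark r_tmp ;; test_eq r_tmp r_stamp ;;
     IfZ r_tmp (put r_vertex_mark r_dst r_stamp))"

definition check_body :: "bound com" where
  "check_body = test_eq r_src r_y ;; IfZ r_tmp (fetch r_tmp r_nbhd_x r_dst ;; IfZ r_tmp (
     fetch r_tmp r_vertex_mark r_dst ;; test_eq r_tmp r_stamp ;;
     IfNZ r_tmp (Ins (Const r_tmp 0) ;; Ins (Store r_tmp r_tmp))))"

definition round_body :: "bound com" where
  "round_body = Ins (Add r_stamp r_vertex r_one) ;;
     edge_loop mark_nbrs_body ;; edge_loop mark_ends_body ;; edge_loop check_body"

definition vertex_body :: "bound com" where
  "vertex_body = fetch r_tmp r_nbhd_x r_vertex ;;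
     IfNZ r_tmp (fetch r_tmp r_nbhd_y r_vertex ;; IfZ r_tmp round_body)"

definition avoidable_prog :: "bound com" where
  "avoidable_prog = load_input ;; init_memory ;; edge_loop nbhd_body ;; vertex_loop init_body ;;
     edge_loop merge_body ;; vertex_loop vertex_body ;; load_from 0 r_ans"

lemma cost_memory_access [simp]:
  "cost \<beta> (load_from i r) = 2" "cost \<beta> (fetch r b s) = 2" "cost \<beta> (put b s r) = 2"
  by (simp_all add: load_from_def fetch_def put_def)

lemma cost_test_eq [simp]: "cost \<beta> (test_eq r s) = 3"
  by (simp add: test_eq_def)

lemma cost_edge_loop [simp]: "cost \<beta> (edge_loop c) = \<beta> Edges * (2 * cost \<beta> c + 10) + 3"
  by (simp add: edge_loop_def load_edge_def swap_ends_def algebra_simps)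

lemma cost_vertex_loop [simp]: "cost \<beta> (vertex_loop c) = \<beta> Vertices * (cost \<beta> c + 4) + 3"
  by (simp add: vertex_loop_def algebra_simps)

lemma cost_avoidable_prog:
  "cost (case_bound n m) avoidable_prog = 148 * (n * m) + 27 * n + 90 * m + 36"
  by (simp add: avoidable_prog_def load_input_def init_memory_def nbhd_body_def init_body_def merge_body_def
      test_outside_def relabel_body_def vertex_body_def round_body_def mark_nbrs_body_def
      mark_ends_body_def check_body_def algebra_simps)

lemma cost_avoidable_prog_le:
  assumes "1 \<le> n" "1 \<le> m"
  shows "cost (case_bound n m) avoidable_prog \<le> 301 * (n * m)"
proof -
  have "n \<le> n * m" "m \<le> n * m" "1 \<le> n * m" using assms by auto
  then show ?thesis unfolding cost_avoidable_prog by linarith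
qed

lemma wp_load_from [simp]: "wp \<beta> (load_from i r) Q R M \<longleftrightarrow> Q (R(r_adr := i, r := M i)) M"
  by (simp add: load_from_def)

lemma wp_fetch [simp]:
  "wp \<beta> (fetch r b i) Q R M \<longleftrightarrow> Q (R(r_adr := R b + R i, r := M (R b + R i))) M"
  by (simp add: fetch_def)

lemma wp_put [simp]:
  "r \<noteq> r_adr \<Longrightarrow> wp \<beta> (put b i r) Q R M \<longleftrightarrow> Q (R(r_adr := R b + R i)) (M(R b + R i := R r))"
  by (simp add: put_def)

lemma wp_test_eq [simp]:
  assumes "r \<noteq> r_aux" "s \<noteq> r_aux"
  shows "wp \<beta> (test_eq r s) Q R M \<longleftrightarrow> Q (R(r_aux := R r - R s, r_tmp := nat \<bar>int (R r) - int (R s)\<bar>)) M"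
proof -
  have "R s - R r + (R r - R s) = nat \<bar>int (R r) - int (R s)\<bar>" by linarith
  then show ?thesis using assms by (simp add: test_eq_def)
qed

lemma wp_test_outside [simp]:
  assumes "r \<noteq> r_tmp" "r \<noteq> r_adr"
  shows "wp \<beta> (test_outside r) Q R M \<longleftrightarrow>
    (let c = M (R r_nbhd_x + R r); d = M (R r_nbhd_y + R r)
     in Q (R(r_adr := R r_nbhd_y + R r, r_aux := d, r_tmp := c + d)) M)"
  using assms by (simp add: test_outside_def Let_def fun_upd_twist)

lemma writes_basic [simp]:
  "writes (fetch r b s) = {r_adr, r}" "writes (put b s r) = {r_adr}"
  "writes (test_eq r s) = {r_aux, r_tmp}" "writes (test_outside r) = {r_adr, r_aux, r_tmp}"
  by (auto simp: fetch_def put_def test_eq_def test_outside_def)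

lemma writes_edge_loop [simp]:
  "writes (edge_loop c) = writes c \<union> {r_src, r_dst, r_pos, r_edges_left, r_tmp}"
  by (auto simp: edge_loop_def load_edge_def swap_ends_def)

lemma writes_vertex_loop [simp]: "writes (vertex_loop c) = writes c \<union> {r_vertex, r_vertices_left}"
  by (auto simp: vertex_loop_def)

lemma writes_bodies [simp]:
  "writes nbhd_body = {r_adr, r_aux, r_tmp}"
  "writes init_body = {r_adr}"
  "writes relabel_body = {r_adr, r_aux, r_tmp}"
  "writes merge_body = {r_adr, r_aux, r_tmp, r_old, r_new, r_vertex, r_vertices_left}"
  "writes mark_nbrs_body = {r_adr, r_aux, r_tmp}"
  "writes mark_ends_body = {r_adr, r_aux, r_tmp}"
  "writes check_body = {r_adr, r_aux, r_tmp}"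
  "writes init_memory = {r_adr}"
  "writes vertex_body = {r_adr, r_aux, r_tmp, r_src, r_dst, r_pos, r_edges_left, r_stamp}"
  by (auto simp: init_memory_def nbhd_body_def init_body_def relabel_body_def merge_body_def mark_nbrs_body_def
      mark_ends_body_def check_body_def round_body_def vertex_body_def)

lemma length_encode: "length (encode n es x y) = 4 + 2 * length es"
  by (induction es) (auto simp: encode_def)

lemma nth_concat_pairs:
  assumes "i < length es"
  shows "concat (map (\<lambda>(u, v). [u, v]) es) ! (2 * i) = fst (es ! i)"
    and "concat (map (\<lambda>(u, v). [u, v]) es) ! Suc (2 * i) = snd (es ! i)"
  using assms by (induction es arbitrary: i) (auto simp: nth_Cons split: nat.splits)

lemma nth_encode:
  "encode n es x y ! 0 = n" "encode n es x y ! 1 = length es"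
  "encode n es x y ! 2 = x" "encode n es x y ! 3 = y"
  "i < length es \<Longrightarrow> encode n es x y ! (4 + 2 * i) = fst (es ! i)"
  "i < length es \<Longrightarrow> encode n es x y ! (5 + 2 * i) = snd (es ! i)"
  using nth_concat_pairs[of i es] by (auto simp: encode_def numeral_eq_Suc)


section \<open>Verification\<close>

lemma insert_Image: "insert (u, v) A `` S = (if u \<in> S then insert v (A `` S) else A `` S)"
  by auto

lemma Restr_symcl_insert:
  "Restr (insert (u, v) A \<union> (insert (u, v) A)\<inverse>) W =
    (if u \<in> W \<and> v \<in> W then insert (u, v) (insert (v, u) (Restr (A \<union> A\<inverse>) W)) else Restr (A \<union> A\<inverse>) W)"
  by auto

locale edge_list =
  fixes n :: nat and es :: "(nat \<times> nat) list" and x y :: nat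
  assumes es_less: "(u, v) \<in> set es \<Longrightarrow> u < n \<and> v < n"
    and x_less: "x < n" and y_less: "y < n" and x_neq_y: "x \<noteq> y"
begin

abbreviation bounds :: "bound \<Rightarrow> nat" where
  "bounds \<equiv> case_bound n (length es)"

definition arcs :: "(nat \<times> nat) set" where
  "arcs = set es \<union> (set es)\<inverse>"

lemma arcs_less: "(u, v) \<in> arcs \<Longrightarrow> u < n \<and> v < n"
  using es_less by (auto simp: arcs_def)

lemma sym_arcs: "sym arcs"
  by (auto simp: arcs_def sym_def)

definition array :: "reg \<Rightarrow> nat" where
  "array r = 4 + 2 * length es + (r - r_nbhd_x) * n"

lemma array_eq_iff:
  assumes "r_nbhd_x \<le> r" "r_nbhd_x \<le> s" "u < n" "v < n"
  shows "array r + u = array s + v \<longleftrightarrow> r = s \<and> u = v"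
proof
  assume "array r + u = array s + v"
  then have eq: "u + (r - r_nbhd_x) * n = v + (s - r_nbhd_x) * n" by (simp add: array_def)
  then have "(u + (r - r_nbhd_x) * n) div n = (v + (s - r_nbhd_x) * n) div n" by simp
  then have "r - r_nbhd_x = s - r_nbhd_x" using assms by simp
  then show "r = s \<and> u = v" using eq assms by simp
qed simp

lemma array_neq_0: "array r \<noteq> 0"
  by (simp add: array_def)

definition initialized :: "(reg \<Rightarrow> nat) \<Rightarrow> bool" where
  "initialized R \<longleftrightarrow> R r_one = 1 \<and> R r_n = n \<and> R r_x = x \<and> R r_y = y \<and>
     R r_nbhd_x = array r_nbhd_x \<and> R r_nbhd_y = array r_nbhd_y \<and> R r_label = array r_label \<and>
     R r_label_mark = array r_label_mark \<and> R r_vertex_mark = array r_vertex_mark"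

lemma initializedD:
  assumes "initialized R"
  shows "R r_one = 1" "R r_n = n" "R r_x = x" "R r_y = y" "R r_nbhd_x = array r_nbhd_x"
    "R r_nbhd_y = array r_nbhd_y" "R r_label = array r_label"
    "R r_label_mark = array r_label_mark" "R r_vertex_mark = array r_vertex_mark"
  using assms by (simp_all add: initialized_def)

lemma initialized_upd [simp]: "r_vertex_mark < r \<Longrightarrow> initialized (R(r := c)) \<longleftrightarrow> initialized R"
  by (simp add: initialized_def)

lemma initialized_unchanged:
  assumes "initialized R" "unchanged S R R'" "S \<inter> {r_one..r_vertex_mark} = {}"
  shows "initialized R'"
proof -
  have "R' r = R r" if "r \<in> {r_one..r_vertex_mark}" for r
    using assms(2,3) that by (auto simp: unchanged_def)
  then show ?thesis using assms(1) by (simp add: initialized_def)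
qed

lemma wp_SeqI_initialized:
  assumes "wp \<beta> c P R M" "initialized R" "writes c \<inter> {r_one..r_vertex_mark} = {}"
    and "\<And>R' M'. initialized R' \<Longrightarrow> unchanged (writes c) R R' \<Longrightarrow> P R' M' \<Longrightarrow> wp \<beta> d Q R' M'"
  shows "wp \<beta> (c ;; d) Q R M"
  using assms(1) by (rule wp_SeqI) (use assms(2-) initialized_unchanged in blast)

definition edges_stored :: "(nat \<Rightarrow> nat) \<Rightarrow> bool" where
  "edges_stored M \<longleftrightarrow> (\<forall>i<length es. M (4 + 2 * i) = fst (es ! i) \<and> M (5 + 2 * i) = snd (es ! i))"

lemma edges_stored_write:
  assumes "edges_stored M"
  shows "edges_stored (M(array r + v := c))" "edges_stored (M(0 := c))"
  using assms by (auto simp: edges_stored_def array_def)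

text \<open>\<open>C\<close> and \<open>S\<close> are the sets of labels and vertices that carry the current stamp \<open>k\<close>. Labels
  index the array at \<open>r_label_mark\<close>, hence the bound on \<open>L\<close>.\<close>

definition represents :: "nat set \<Rightarrow> nat set \<Rightarrow> (nat \<Rightarrow> nat) \<Rightarrow> nat \<Rightarrow> nat set \<Rightarrow> nat set \<Rightarrow> bool \<Rightarrow> (nat \<Rightarrow> nat) \<Rightarrow> bool" where
  "represents X Y L k C S b M \<longleftrightarrow> edges_stored M \<and> M 0 = of_bool b \<and>
     (\<forall>v<n. M (array r_nbhd_x + v) = of_bool (v \<in> X) \<and> M (array r_nbhd_y + v) = of_bool (v \<in> Y) \<and>
        M (array r_label + v) = L v \<and> L v < n \<and>
        M (array r_label_mark + v) \<le> k \<and> (M (array r_label_mark + v) = k \<longleftrightarrow> v \<in> C) \<and>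
        M (array r_vertex_mark + v) \<le> k \<and> (M (array r_vertex_mark + v) = k \<longleftrightarrow> v \<in> S))"

lemma represents_edges_stored: "represents X Y L k C S b M \<Longrightarrow> edges_stored M"
  by (simp add: represents_def)

lemma represents_read:
  assumes "represents X Y L k C S b M" "v < n"
  shows "M (array r_nbhd_x + v) = of_bool (v \<in> X)" "M (array r_nbhd_y + v) = of_bool (v \<in> Y)"
    "M (array r_label + v) = L v" "L v < n"
    "M (array r_label_mark + v) = k \<longleftrightarrow> v \<in> C" "M (array r_vertex_mark + v) = k \<longleftrightarrow> v \<in> S"
  using assms by (simp_all add: represents_def)

lemma represents_write:
  assumes "represents X Y L k C S b M" "v < n"
  shows "represents (insert v X) Y L k C S b (M(array r_nbhd_x + v := 1))"
    and "represents X (insert v Y) L k C S b (M(array r_nbhd_y + v := 1))"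
    and "c < n \<Longrightarrow> represents X Y (L(v := c)) k C S b (M(array r_label + v := c))"
    and "represents X Y L k (insert v C) S b (M(array r_label_mark + v := k))"
    and "represents X Y L k C (insert v S) b (M(array r_vertex_mark + v := k))"
  using assms unfolding represents_def
  by (simp_all add: edges_stored_write array_eq_iff array_neq_0)

lemma represents_reject: "represents X Y L k C S b M \<Longrightarrow> represents X Y L k C S False (M(0 := 0))"
  by (simp add: represents_def edges_stored_write array_neq_0)

lemma represents_cong: "represents X Y L k C S b M \<Longrightarrow> (\<And>v. v < n \<Longrightarrow> L v = L' v) \<Longrightarrow> represents X Y L' k C S b M"
  by (simp add: represents_def)

lemma represents_new_stamp: "represents X Y L k C S b M \<Longrightarrow> represents X Y L (Suc k) {} {} b M"
  by (fastforce simp: represents_def)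


subsection \<open>Loop rules\<close>

lemma wp_load_edge:
  assumes "initialized R" "edges_stored M" "k < length es" "R r_pos = 4 + 2 * k"
  shows "wp \<beta> load_edge (\<lambda>R' M'. M' = M \<and> R' r_src = fst (es ! k) \<and> R' r_dst = snd (es ! k) \<and>
    R' r_pos = 4 + 2 * Suc k) R M"
  using assms(2-) initializedD(1)[OF assms(1)] by (simp add: load_edge_def edges_stored_def)

text \<open>\<open>I A\<close> describes the memory after the arcs in \<open>A\<close> have been processed; every listed edge
  contributes both its arcs.\<close>

context
  fixes c :: "bound com" and I :: "(nat \<times> nat) set \<Rightarrow> (nat \<Rightarrow> nat) \<Rightarrow> bool" and R\<^sub>0 :: "reg \<Rightarrow> nat"
  assumes init: "initialized R\<^sub>0"
    and disj: "writes c \<inter> ({r_one..r_vertex_mark} \<union> {r_src, r_dst, r_pos}) = {}"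
    and stored: "\<And>A M. I A M \<Longrightarrow> edges_stored M"
    and body: "\<And>A u v R M. initialized R \<Longrightarrow> unchanged (writes (edge_loop c)) R\<^sub>0 R \<Longrightarrow> (u, v) \<in> arcs \<Longrightarrow>
      R r_src = u \<Longrightarrow> R r_dst = v \<Longrightarrow> I A M \<Longrightarrow> wp bounds c (\<lambda>_. I (insert (u, v) A)) R M"
begin

lemma initialized_in_edge_loop: "unchanged (writes (edge_loop c)) R\<^sub>0 R \<Longrightarrow> initialized R"
  using init by (rule initialized_unchanged) (use disj in auto)

lemma wp_both_orientations:
  assumes R: "unchanged (writes (edge_loop c)) R\<^sub>0 R"
    and arc: "(u, v) \<in> arcs" "R r_src = u" "R r_dst = v" and I: "I A M"
  shows "wp bounds (c ;; swap_ends ;; c)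
    (\<lambda>R' M'. I (insert (v, u) (insert (u, v) A)) M' \<and> R' r_pos = R r_pos) R M"
proof (rule wp_SeqI[OF body[OF initialized_in_edge_loop[OF R] R arc I]])
  fix R\<^sub>1 M\<^sub>1 assume keep: "unchanged (writes c) R R\<^sub>1" and I\<^sub>1: "I (insert (u, v) A) M\<^sub>1"
  let ?R = "R\<^sub>1(r_tmp := u, r_src := v, r_dst := u)"
  have R\<^sub>1: "R\<^sub>1 r_src = u" "R\<^sub>1 r_dst = v" "R\<^sub>1 r_pos = R r_pos"
    using disj arc unchangedD[OF keep] by auto
  have "unchanged (writes (edge_loop c)) R R\<^sub>1"
    using keep by (rule unchanged_mono) auto
  moreover have "unchanged (writes (edge_loop c)) R\<^sub>1 ?R"
    by (simp add: unchanged_def)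
  ultimately have R': "unchanged (writes (edge_loop c)) R\<^sub>0 ?R"
    using R by (blast intro: unchanged_trans)
  have "(v, u) \<in> arcs" using arc(1) sym_arcs by (auto dest: symD)
  then have "wp bounds c (\<lambda>_. I (insert (v, u) (insert (u, v) A))) ?R M\<^sub>1"
    by (rule body[OF initialized_in_edge_loop[OF R'] R' _ _ _ I\<^sub>1]) simp_all
  then have "wp bounds c (\<lambda>R' M'. I (insert (v, u) (insert (u, v) A)) M' \<and> R' r_pos = R r_pos) ?R M\<^sub>1"
    by (rule wp_conseq) (use disj R\<^sub>1(3) in \<open>auto dest: unchangedD[of _ _ _ r_pos]\<close>)
  then show "wp bounds (swap_ends ;; c)
      (\<lambda>R' M'. I (insert (v, u) (insert (u, v) A)) M' \<and> R' r_pos = R r_pos) R\<^sub>1 M\<^sub>1"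
    by (simp add: swap_ends_def R\<^sub>1)
qed

definition edge_loop_inv :: "nat \<Rightarrow> assertion" where
  "edge_loop_inv k R M \<longleftrightarrow> unchanged (writes (edge_loop c)) R\<^sub>0 R \<and>
     I (set (take k es) \<union> (set (take k es))\<inverse>) M \<and>
     R r_pos = 4 + 2 * k \<and> R r_edges_left = 2 * (length es - k)"

lemma wp_edge_loop_body:
  assumes k: "k < length es" and inv: "edge_loop_inv k R M"
  shows "wp bounds (load_edge ;; (c ;; swap_ends ;; c) ;; Ins (Sub r_edges_left r_nbhd_x r_pos))
    (edge_loop_inv (Suc k)) R M"
proof -
  let ?W = "writes (edge_loop c)" and ?A = "set (take k es) \<union> (set (take k es))\<inverse>"
  have R: "unchanged ?W R\<^sub>0 R" and I: "I ?A M" and pos: "R r_pos = 4 + 2 * k"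
    using inv by (simp_all add: edge_loop_inv_def)
  obtain u v where uv: "es ! k = (u, v)" by fastforce
  have arc: "(u, v) \<in> arcs" using nth_mem[OF k] uv by (simp add: arcs_def)
  have take_Suc: "set (take (Suc k) es) \<union> (set (take (Suc k) es))\<inverse> = insert (v, u) (insert (u, v) ?A)"
    using k uv by (auto simp: take_Suc_conv_app_nth)
  show ?thesis
  proof (rule wp_SeqI[OF wp_load_edge[OF initialized_in_edge_loop[OF R] stored[OF I] k pos]])
    fix R\<^sub>1 M\<^sub>1 assume "unchanged (writes load_edge) R R\<^sub>1" and
      loaded: "M\<^sub>1 = M \<and> R\<^sub>1 r_src = fst (es ! k) \<and> R\<^sub>1 r_dst = snd (es ! k) \<and> R\<^sub>1 r_pos = 4 + 2 * Suc k"
    then have "unchanged ?W R R\<^sub>1"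
      by (auto simp: load_edge_def elim: unchanged_mono)
    note R\<^sub>1 = unchanged_trans[OF R this]
    show "wp bounds ((c ;; swap_ends ;; c) ;; Ins (Sub r_edges_left r_nbhd_x r_pos))
        (edge_loop_inv (Suc k)) R\<^sub>1 M\<^sub>1"
    proof (rule wp_SeqI[OF wp_both_orientations[OF R\<^sub>1 arc]])
      fix R\<^sub>2 M\<^sub>2 assume "unchanged (writes (c ;; swap_ends ;; c)) R\<^sub>1 R\<^sub>2"
        and processed: "I (insert (v, u) (insert (u, v) ?A)) M\<^sub>2 \<and> R\<^sub>2 r_pos = R\<^sub>1 r_pos"
      then have "unchanged ?W R\<^sub>1 R\<^sub>2"
        by (auto simp: swap_ends_def elim: unchanged_mono)
      note R\<^sub>2 = unchanged_trans[OF R\<^sub>1 this]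
      then show "wp bounds (Ins (Sub r_edges_left r_nbhd_x r_pos)) (edge_loop_inv (Suc k)) R\<^sub>2 M\<^sub>2"
        using loaded processed initializedD(5)[OF initialized_in_edge_loop[OF R\<^sub>2]]
        by (simp add: edge_loop_inv_def take_Suc array_def unchanged_def)
    qed (use loaded I uv in auto)
  qed
qed

lemma wp_edge_loop:
  assumes "I {} M"
  shows "wp bounds (edge_loop c) (\<lambda>_. I arcs) R\<^sub>0 M"
proof -
  let ?m = "length es"
  let ?body = "load_edge ;; (c ;; swap_ends ;; c) ;; Ins (Sub r_edges_left r_nbhd_x r_pos)"
  have "wp bounds (While Edges r_edges_left ?body) (\<lambda>_. I arcs) R M" if "edge_loop_inv 0 R M" for R
    by (rule wp_WhileI[where N = ?m and I = edge_loop_inv])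
      (use that wp_edge_loop_body in \<open>auto simp: edge_loop_inv_def arcs_def\<close>)
  moreover have "edge_loop_inv 0 (R\<^sub>0(r_pos := 4, r_edges_left := 2 * ?m)) M"
    using assms by (simp add: edge_loop_inv_def unchanged_def)
  ultimately show ?thesis
    using initializedD(5)[OF init] by (simp add: edge_loop_def array_def)
qed

end

context
  fixes c :: "bound com" and I :: "nat \<Rightarrow> (nat \<Rightarrow> nat) \<Rightarrow> bool" and R\<^sub>0 :: "reg \<Rightarrow> nat"
  assumes init: "initialized R\<^sub>0" and disj: "writes c \<inter> ({r_one..r_vertex_mark} \<union> {r_vertex}) = {}"
    and body: "\<And>v R M. initialized R \<Longrightarrow> unchanged (writes (vertex_loop c)) R\<^sub>0 R \<Longrightarrow> v < n \<Longrightarrow>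
      R r_vertex = v \<Longrightarrow> I v M \<Longrightarrow> wp bounds c (\<lambda>_. I (Suc v)) R M"
begin

lemma initialized_in_vertex_loop: "unchanged (writes (vertex_loop c)) R\<^sub>0 R \<Longrightarrow> initialized R"
  using init by (rule initialized_unchanged) (use disj in auto)

definition vertex_loop_inv :: "nat \<Rightarrow> assertion" where
  "vertex_loop_inv k R M \<longleftrightarrow>
     unchanged (writes (vertex_loop c)) R\<^sub>0 R \<and> I k M \<and> R r_vertex = k \<and> R r_vertices_left = n - k"

lemma wp_vertex_loop_body:
  assumes k: "k < n" and inv: "vertex_loop_inv k R M"
  shows "wp bounds (c ;; Ins (Add r_vertex r_vertex r_one) ;; Ins (Sub r_vertices_left r_n r_vertex))
    (vertex_loop_inv (Suc k)) R M"
proof -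
  have R: "unchanged (writes (vertex_loop c)) R\<^sub>0 R" and vertex: "R r_vertex = k" and I: "I k M"
    using inv by (simp_all add: vertex_loop_inv_def)
  show ?thesis
  proof (rule wp_SeqI[OF body[OF initialized_in_vertex_loop[OF R] R k vertex I]])
    fix R\<^sub>1 M\<^sub>1 assume keep: "unchanged (writes c) R R\<^sub>1" and I\<^sub>1: "I (Suc k) M\<^sub>1"
    then have "unchanged (writes (vertex_loop c)) R R\<^sub>1" by (auto elim: unchanged_mono)
    note R\<^sub>1 = unchanged_trans[OF R this]
    have "R\<^sub>1 r_vertex = k" using disj unchangedD[OF keep, of r_vertex] vertex by auto
    then show "wp bounds (Ins (Add r_vertex r_vertex r_one) ;; Ins (Sub r_vertices_left r_n r_vertex))
        (vertex_loop_inv (Suc k)) R\<^sub>1 M\<^sub>1"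
      using I\<^sub>1 R\<^sub>1 initializedD(1,2)[OF initialized_in_vertex_loop[OF R\<^sub>1]]
      by (simp add: vertex_loop_inv_def unchanged_def)
  qed
qed

lemma wp_vertex_loop:
  assumes "I 0 M"
  shows "wp bounds (vertex_loop c) (\<lambda>_. I n) R\<^sub>0 M"
proof -
  let ?body = "c ;; Ins (Add r_vertex r_vertex r_one) ;; Ins (Sub r_vertices_left r_n r_vertex)"
  have "wp bounds (While Vertices r_vertices_left ?body) (\<lambda>_. I n) R M" if "vertex_loop_inv 0 R M" for R
    by (rule wp_WhileI[where N = n and I = vertex_loop_inv])
      (use that wp_vertex_loop_body in \<open>auto simp: vertex_loop_inv_def\<close>)
  moreover have "vertex_loop_inv 0 (R\<^sub>0(r_vertex := 0, r_vertices_left := n)) M"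
    using assms by (simp add: vertex_loop_inv_def unchanged_def)
  ultimately show ?thesis
    using initializedD(2)[OF init] by (simp add: vertex_loop_def)
qed

end


subsection \<open>The passes over vertices and edges\<close>

lemma wp_nbhd_loop:
  assumes "initialized R" "represents X Y L k C S b M"
  shows "wp bounds (edge_loop nbhd_body) (\<lambda>_. represents (X \<union> arcs `` {x}) (Y \<union> arcs `` {y}) L k C S b) R M"
proof (rule wp_edge_loop[where I = "\<lambda>A. represents (X \<union> A `` {x}) (Y \<union> A `` {y}) L k C S b"])
  fix A u v R M
  assume init: "initialized R" and arc: "(u, v) \<in> arcs" and R: "R r_src = u" "R r_dst = v"
    and rep: "represents (X \<union> A `` {x}) (Y \<union> A `` {y}) L k C S b M"
  have "v < n" using arcs_less[OF arc] by simp
  then show "wp bounds nbhd_body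
      (\<lambda>_. represents (X \<union> insert (u, v) A `` {x}) (Y \<union> insert (u, v) A `` {y}) L k C S b) R M"
    using represents_write(1,2)[OF rep] rep x_neq_y
    by (auto simp: nbhd_body_def initializedD[OF init] R insert_Image)
qed (use assms in \<open>auto simp: represents_edges_stored\<close>)

lemma wp_init_loop:
  assumes "initialized R" "represents X Y L k C S b M"
  shows "wp bounds (vertex_loop init_body) (\<lambda>_. represents X Y id k C S b) R M"
proof -
  have "wp bounds (vertex_loop init_body) (\<lambda>_. represents X Y (\<lambda>v. if v < n then v else L v) k C S b) R M"
  proof (rule wp_vertex_loop[where I = "\<lambda>w. represents X Y (\<lambda>v. if v < w then v else L v) k C S b"])
    fix w R M
    assume init: "initialized R" and w: "w < n" and R: "R r_vertex = w"
      and rep: "represents X Y (\<lambda>v. if v < w then v else L v) k C S b M"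
    have "(\<lambda>v. if v < Suc w then v else L v) = (\<lambda>v. if v < w then v else L v)(w := w)"
      by (auto simp: fun_eq_iff)
    then show "wp bounds init_body (\<lambda>_. represents X Y (\<lambda>v. if v < Suc w then v else L v) k C S b) R M"
      using represents_write(3)[OF rep w w] by (simp add: init_body_def initializedD[OF init] R)
  qed (use assms in auto)
  then show ?thesis by (rule wp_conseq) (auto elim: represents_cong)
qed

lemma wp_relabel_loop:
  assumes "initialized R" and "represents X Y L k C S b M" and labels: "R r_old = c" "R r_new = d" "d < n"
  shows "wp bounds (vertex_loop relabel_body) (\<lambda>_. represents X Y (relabel c d L) k C S b) R M"
proof -
  let ?L = "\<lambda>w v. if v < w then relabel c d L v else L v"
  have "wp bounds (vertex_loop relabel_body) (\<lambda>_. represents X Y (?L n) k C S b) R M"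
  proof (rule wp_vertex_loop[where I = "\<lambda>w. represents X Y (?L w) k C S b"])
    fix w R' M
    assume init: "initialized R'" and unch: "unchanged (writes (vertex_loop relabel_body)) R R'"
      and w: "w < n" and R': "R' r_vertex = w" and rep: "represents X Y (?L w) k C S b M"
    have "R' r_old = c" "R' r_new = d"
      using labels unchangedD[OF unch] by simp_all
    moreover have "?L (Suc w) = (if L w = c then (?L w)(w := d) else ?L w)"
      by (auto simp: fun_eq_iff relabel_def less_Suc_eq)
    ultimately show "wp bounds relabel_body (\<lambda>_. represents X Y (?L (Suc w)) k C S b) R' M"
      using represents_write(3)[OF rep w labels(3)] rep
      by (simp add: relabel_body_def initializedD[OF init] R' represents_read[OF rep w])
  qed (use assms in auto)
  then show ?thesis by (rule wp_conseq) (auto elim: represents_cong)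
qed

lemma wp_merge_body:
  assumes init: "initialized R" and rep: "represents X Y L k C S b M"
    and R: "R r_src = u" "R r_dst = v" "u < n" "v < n"
  defines "L' \<equiv> if u \<in> - (X \<union> Y) \<and> v \<in> - (X \<union> Y) then relabel (L u) (L v) L else L"
  shows "wp bounds merge_body (\<lambda>_. represents X Y L' k C S b) R M"
proof -
  note read = represents_read[OF rep \<open>u < n\<close>] represents_read[OF rep \<open>v < n\<close>]
  have "wp bounds (vertex_loop relabel_body) (\<lambda>_. represents X Y (relabel (L u) (L v) L) k C S b) R' M"
    if "initialized R'" "R' r_old = L u" "R' r_new = L v" for R'
    using that rep read(10) by (intro wp_relabel_loop)
  then show ?thesis
    using rep init by (simp add: merge_body_def L'_def initializedD[OF init] R read Let_def)
qed

lemma wp_merge_loop: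
  assumes "initialized R" "represents X Y id k C S b M"
  shows "wp bounds (edge_loop merge_body) (\<lambda>_ M. \<exists>L. represents X Y L k C S b M \<and>
    (\<forall>u v. L u = L v \<longleftrightarrow> (u, v) \<in> (Restr arcs (- (X \<union> Y)))\<^sup>*)) R M"
proof -
  let ?W = "- (X \<union> Y)"
  let ?I = "\<lambda>A M. \<exists>L. represents X Y L k C S b M \<and> (\<forall>u v. L u = L v \<longleftrightarrow> (u, v) \<in> (Restr (A \<union> A\<inverse>) ?W)\<^sup>*)"
  have "wp bounds (edge_loop merge_body) (\<lambda>_. ?I arcs) R M"
  proof (rule wp_edge_loop[where I = ?I])
    fix A u v R M
    assume init: "initialized R" and arc: "(u, v) \<in> arcs" and R: "R r_src = u" "R r_dst = v" and "?I A M"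
    then obtain L where rep: "represents X Y L k C S b M"
      and L: "\<And>u v. L u = L v \<longleftrightarrow> (u, v) \<in> (Restr (A \<union> A\<inverse>) ?W)\<^sup>*" by blast
    let ?L = "if u \<in> ?W \<and> v \<in> ?W then relabel (L u) (L v) L else L"
    have "\<forall>p q. ?L p = ?L q \<longleftrightarrow>
        (p, q) \<in> (Restr (insert (u, v) A \<union> (insert (u, v) A)\<inverse>) ?W)\<^sup>*"
      unfolding Restr_symcl_insert
      by (cases "u \<in> ?W \<and> v \<in> ?W") (simp_all only: if_True if_False L relabel_eq_iff[OF L] simp_thms)
    moreover have "wp bounds merge_body (\<lambda>_. represents X Y ?L k C S b) R M"
      by (rule wp_merge_body[OF init rep R]) (use arcs_less[OF arc] in simp_all)
    ultimately show "wp bounds merge_body (\<lambda>_. ?I (insert (u, v) A)) R M"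
      by (blast intro: wp_conseq)
  qed (use assms in \<open>auto simp: represents_edges_stored\<close>)
  moreover have "arcs \<union> arcs\<inverse> = arcs" by (auto simp: arcs_def)
  ultimately show ?thesis by simp
qed

lemma wp_mark_nbrs_loop:
  assumes "initialized R" and R: "R r_vertex = a" "R r_stamp = k" and "represents X Y L k C S b M"
  shows "wp bounds (edge_loop mark_nbrs_body)
    (\<lambda>_. represents X Y L k (C \<union> L ` (arcs `` {a})) (S \<union> arcs `` {a}) b) R M"
proof (rule wp_edge_loop[where I = "\<lambda>A. represents X Y L k (C \<union> L ` (A `` {a})) (S \<union> A `` {a}) b"])
  fix A u v R' M
  assume init: "initialized R'" and unch: "unchanged (writes (edge_loop mark_nbrs_body)) R R'"
    and arc: "(u, v) \<in> arcs" and R': "R' r_src = u" "R' r_dst = v"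
    and rep: "represents X Y L k (C \<union> L ` (A `` {a})) (S \<union> A `` {a}) b M"
  have kept: "R' r_vertex = a" "R' r_stamp = k"
    using R unchangedD[OF unch] by simp_all
  have v: "v < n" using arcs_less[OF arc] by simp
  note vertex_marked = represents_write(5)[OF rep v]
  note marked = represents_write(4)[OF vertex_marked represents_read(4)[OF vertex_marked v]]
  show "wp bounds mark_nbrs_body
      (\<lambda>_. represents X Y L k (C \<union> L ` (insert (u, v) A `` {a})) (S \<union> insert (u, v) A `` {a}) b) R' M"
    using marked rep represents_read(3)[OF vertex_marked v]
    by (simp add: mark_nbrs_body_def initializedD[OF init] R' kept insert_Image)
qed (use assms in \<open>auto simp: represents_edges_stored\<close>)

lemma wp_mark_ends_loop:
  assumes "initialized R" and R: "R r_stamp = k" and "represents X Y L k C S b M"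
  defines "U \<equiv> - (X \<union> Y) \<inter> L -` C"
  shows "wp bounds (edge_loop mark_ends_body) (\<lambda>_. represents X Y L k C (S \<union> arcs `` U) b) R M"
proof (rule wp_edge_loop[where I = "\<lambda>A. represents X Y L k C (S \<union> A `` U) b"])
  fix A u v R' M
  assume init: "initialized R'" and unch: "unchanged (writes (edge_loop mark_ends_body)) R R'"
    and arc: "(u, v) \<in> arcs" and R': "R' r_src = u" "R' r_dst = v"
    and rep: "represents X Y L k C (S \<union> A `` U) b M"
  have kept: "R' r_stamp = k"
    using R unchangedD[OF unch] by simp
  have uv: "u < n" "v < n" using arcs_less[OF arc] by simp_all
  note read = represents_read[OF rep uv(1)]
  show "wp bounds mark_ends_body (\<lambda>_. represents X Y L k C (S \<union> insert (u, v) A `` U) b) R' M"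
    using represents_write(5)[OF rep uv(2)] rep
    by (simp add: mark_ends_body_def initializedD[OF init] R' kept insert_Image U_def read
        represents_read(5)[OF rep read(4)] Let_def)
qed (use assms in \<open>auto simp: represents_edges_stored\<close>)

lemma wp_check_loop:
  assumes "initialized R" and R: "R r_stamp = k" and "represents X Y L k C S b M"
  shows "wp bounds (edge_loop check_body) (\<lambda>_. represents X Y L k C S (b \<and> arcs `` {y} - X \<subseteq> S)) R M"
proof (rule wp_edge_loop[where I = "\<lambda>A. represents X Y L k C S (b \<and> A `` {y} - X \<subseteq> S)"])
  fix A u v R' M
  assume init: "initialized R'" and unch: "unchanged (writes (edge_loop check_body)) R R'"
    and arc: "(u, v) \<in> arcs" and R': "R' r_src = u" "R' r_dst = v"
    and rep: "represents X Y L k C S (b \<and> A `` {y} - X \<subseteq> S) M"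
  have kept: "R' r_stamp = k"
    using R unchangedD[OF unch] by simp
  have "v < n" using arcs_less[OF arc] by simp
  note read = represents_read[OF rep this]
  show "wp bounds check_body (\<lambda>_. represents X Y L k C S (b \<and> insert (u, v) A `` {y} - X \<subseteq> S)) R' M"
    using represents_reject[OF rep] rep
    by (simp add: check_body_def initializedD[OF init] R' kept insert_Image insert_Diff_if read)
qed (use assms in \<open>auto simp: represents_edges_stored\<close>)

definition reached :: "nat set \<Rightarrow> (nat \<Rightarrow> nat) \<Rightarrow> nat \<Rightarrow> nat set" where
  "reached W L a = arcs `` insert a (W \<inter> L -` L ` (arcs `` {a}))"

lemma wp_round_body:
  assumes init: "initialized R" and a: "R r_vertex = a" and rep: "represents X Y L (Suc a) {} {} b M"
  shows "wp bounds round_body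
    (\<lambda>_ M. \<exists>C S. represents X Y L (Suc a) C S (b \<and> arcs `` {y} - X \<subseteq> reached (- (X \<union> Y)) L a) M) R M"
proof -
  let ?C = "L ` (arcs `` {a})" and ?S = "reached (- (X \<union> Y)) L a"
  let ?Q = "\<lambda>_ M. \<exists>C S. represents X Y L (Suc a) C S (b \<and> arcs `` {y} - X \<subseteq> ?S) M"
  have S: "arcs `` {a} \<union> arcs `` (- (X \<union> Y) \<inter> L -` ?C) = ?S" by (auto simp: reached_def)
  have "wp bounds (edge_loop mark_nbrs_body ;; edge_loop mark_ends_body ;; edge_loop check_body) ?Q R\<^sub>0 M"
    if R\<^sub>0: "initialized R\<^sub>0" "R\<^sub>0 r_vertex = a" "R\<^sub>0 r_stamp = Suc a" for R\<^sub>0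
  proof (rule wp_SeqI_initialized[OF wp_mark_nbrs_loop[OF R\<^sub>0 rep] R\<^sub>0(1)])
    fix R\<^sub>1 M\<^sub>1 assume R\<^sub>1: "initialized R\<^sub>1" "unchanged (writes (edge_loop mark_nbrs_body)) R\<^sub>0 R\<^sub>1"
      and "represents X Y L (Suc a) ({} \<union> ?C) ({} \<union> arcs `` {a}) b M\<^sub>1"
    then have rep\<^sub>1: "represents X Y L (Suc a) ?C (arcs `` {a}) b M\<^sub>1" by simp
    have stamp\<^sub>1: "R\<^sub>1 r_stamp = Suc a" using unchangedD[OF R\<^sub>1(2)] R\<^sub>0(3) by simp
    show "wp bounds (edge_loop mark_ends_body ;; edge_loop check_body) ?Q R\<^sub>1 M\<^sub>1"
    proof (rule wp_SeqI_initialized[OF wp_mark_ends_loop[OF R\<^sub>1(1) stamp\<^sub>1 rep\<^sub>1, unfolded S] R\<^sub>1(1)])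
      fix R\<^sub>2 M\<^sub>2 assume R\<^sub>2: "initialized R\<^sub>2" "unchanged (writes (edge_loop mark_ends_body)) R\<^sub>1 R\<^sub>2"
        and rep\<^sub>2: "represents X Y L (Suc a) ?C ?S b M\<^sub>2"
      have stamp\<^sub>2: "R\<^sub>2 r_stamp = Suc a" using unchangedD[OF R\<^sub>2(2)] stamp\<^sub>1 by simp
      show "wp bounds (edge_loop check_body) ?Q R\<^sub>2 M\<^sub>2"
        using wp_check_loop[OF R\<^sub>2(1) stamp\<^sub>2 rep\<^sub>2] by (rule wp_conseq) blast
    qed simp
  qed simp
  then show ?thesis
    using init a initializedD[OF init] by (simp add: round_body_def)
qed

definition nbrs_reached :: "nat set \<Rightarrow> nat set \<Rightarrow> (nat \<Rightarrow> nat) \<Rightarrow> nat \<Rightarrow> bool" where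
  "nbrs_reached X Y L a \<longleftrightarrow> (a \<in> X - Y \<longrightarrow> arcs `` {y} - X \<subseteq> reached (- (X \<union> Y)) L a)"

lemma wp_main_loop:
  assumes "initialized R" "represents X Y L 0 C S True M"
  shows "wp bounds (vertex_loop vertex_body)
    (\<lambda>_ M. \<exists>C S. represents X Y L n C S (\<forall>a<n. nbrs_reached X Y L a) M) R M"
proof (rule wp_vertex_loop[where I = "\<lambda>w M. \<exists>C S. represents X Y L w C S (\<forall>a<w. nbrs_reached X Y L a) M"])
  fix a R M
  assume init: "initialized R" and a: "a < n" "R r_vertex = a"
    and "\<exists>C S. represents X Y L a C S (\<forall>a'<a. nbrs_reached X Y L a') M"
  then obtain C S where rep: "represents X Y L a C S (\<forall>a'<a. nbrs_reached X Y L a') M" by blast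
  note read = represents_read[OF rep a(1)]
  note fresh = represents_new_stamp[OF rep]
  let ?Q = "\<lambda>_ M. \<exists>C S. represents X Y L (Suc a) C S (\<forall>a'<Suc a. nbrs_reached X Y L a') M"
  have all: "(\<forall>a'<Suc a. nbrs_reached X Y L a') \<longleftrightarrow> (\<forall>a'<a. nbrs_reached X Y L a') \<and> nbrs_reached X Y L a"
    by (auto simp: less_Suc_eq)
  have "wp bounds round_body ?Q R' M" if "a \<in> X - Y" "initialized R'" "R' r_vertex = a" for R'
    using wp_round_body[OF that(2,3) fresh] that(1) unfolding all by (simp add: nbrs_reached_def)
  moreover have "?Q R' M" if "a \<notin> X - Y" for R'
    using fresh that unfolding all by (intro exI[of _ "{}"]) (auto simp: nbrs_reached_def)
  ultimately show "wp bounds vertex_body ?Q R M"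
    using init a(2) by (simp add: vertex_body_def initializedD[OF init] read)
qed (use assms in auto)


subsection \<open>Correctness of the program\<close>

abbreviation input :: "nat \<Rightarrow> nat" where
  "input \<equiv> mem (initial (encode n es x y))"

lemma input_eq:
  "input 0 = n" "input (Suc 0) = length es" "input 2 = x" "input 3 = y" "input (array r + v) = 0"
  "edges_stored input"
  using nth_encode(1-4)[of n es x y] nth_encode(5,6)[where n = n and es = es and x = x and y = y]
  by (simp_all add: initial_def length_encode array_def edges_stored_def)

lemma wp_load_input: "wp \<beta> load_input (\<lambda>R M. initialized R \<and> M = input) (\<lambda>_. 0) input"
  by (simp add: load_input_def initialized_def input_eq array_def)

lemma wp_init_memory:
  assumes "initialized R"
  shows "wp \<beta> init_memory (\<lambda>_. represents {x} {y} (\<lambda>_. 0) 0 UNIV UNIV True) R input"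
proof -
  have "represents {} {} (\<lambda>_. 0) 0 UNIV UNIV True (input(0 := 1))"
    using x_less by (simp add: represents_def input_eq edges_stored_write array_neq_0)
  from represents_write(2)[OF represents_write(1)[OF this x_less] y_less] show ?thesis
    by (simp add: init_memory_def initializedD[OF assms])
qed

lemma wp_avoidable_prog:
  defines "X \<equiv> {x} \<union> arcs `` {x}" and "Y \<equiv> {y} \<union> arcs `` {y}"
  shows "wp bounds avoidable_prog (\<lambda>R _. \<exists>L. (\<forall>u v. L u = L v \<longleftrightarrow> (u, v) \<in> (Restr arcs (- (X \<union> Y)))\<^sup>*) \<and>
      R r_ans = of_bool (\<forall>a<n. nbrs_reached X Y L a)) (\<lambda>_. 0) input"
    (is "wp _ _ ?Q _ _")
proof -
  let ?rounds = "vertex_loop vertex_body ;; load_from 0 r_ans"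
  let ?merge = "edge_loop merge_body ;; ?rounds"
  let ?labels = "vertex_loop init_body ;; ?merge"
  let ?nbhds = "edge_loop nbhd_body ;; ?labels"
  have rounds: "wp bounds ?rounds ?Q R M"
    if "initialized R" "represents X Y L 0 UNIV UNIV True M"
      "\<forall>u v. L u = L v \<longleftrightarrow> (u, v) \<in> (Restr arcs (- (X \<union> Y)))\<^sup>*" for L R M
    using wp_main_loop[OF that(1,2)] by (rule wp_SeqI) (use that(3) in \<open>auto simp: represents_def\<close>)
  have merge: "wp bounds ?merge ?Q R M" if "initialized R" "represents X Y id 0 UNIV UNIV True M" for R M
    by (rule wp_SeqI_initialized[OF wp_merge_loop[OF that] that(1)]) (simp, use rounds in blast)
  have labels: "wp bounds ?labels ?Q R M" if "initialized R" "represents X Y (\<lambda>_. 0) 0 UNIV UNIV True M" for R M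
    by (rule wp_SeqI_initialized[OF wp_init_loop[OF that] that(1)]) (use merge in auto)
  have nbhds: "wp bounds ?nbhds ?Q R M" if "initialized R" "represents {x} {y} (\<lambda>_. 0) 0 UNIV UNIV True M" for R M
    by (rule wp_SeqI_initialized[OF wp_nbhd_loop[OF that] that(1)]) (use labels in \<open>auto simp: X_def Y_def\<close>)
  have "wp bounds (init_memory ;; ?nbhds) ?Q R input" if "initialized R" for R
    by (rule wp_SeqI_initialized[OF wp_init_memory[OF that] that]) (use nbhds in auto)
  then show ?thesis
    unfolding avoidable_prog_def by (intro wp_SeqI[OF wp_load_input]) auto
qed

lemma mem_reached_iff:
  assumes arcs: "arcs = adj E" and L: "\<And>u v. L u = L v \<longleftrightarrow> (u, v) \<in> (Restr arcs W)\<^sup>*"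
  shows "b \<in> reached W L a \<longleftrightarrow> {a, b} \<in> E \<or> linked_through E W a b"
proof -
  have conn: "(w, u) \<in> (Restr arcs W)\<^sup>* \<longleftrightarrow> L u = L w" for u w
    unfolding L[symmetric] by (rule eq_commute)
  have "w \<in> W" if "(w, u) \<in> (Restr arcs W)\<^sup>*" "u \<in> W" for u w
    using that by (induction rule: converse_rtrancl_induct) auto
  note W = this[unfolded conn]
  have "L u \<in> L ` (adj E `` {a}) \<longleftrightarrow> (\<exists>w. {a, w} \<in> E \<and> L u = L w)" for u
    by auto
  then have "b \<in> reached W L a \<longleftrightarrow> {a, b} \<in> E \<or> (\<exists>u\<in>W. \<exists>w. {a, w} \<in> E \<and> L u = L w \<and> {u, b} \<in> E)"
    by (auto simp: reached_def arcs Image_iff)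
  also have "(\<exists>u\<in>W. \<exists>w. {a, w} \<in> E \<and> L u = L w \<and> {u, b} \<in> E) \<longleftrightarrow> linked_through E W a b"
    unfolding linked_through_def arcs[symmetric] conn using W by blast
  finally show ?thesis .
qed

lemma nbrs_reached_iff_avoidable_edge:
  assumes g: "ugraph {..<n} E" and arcs: "arcs = adj E" and xy: "{x, y} \<in> E"
    and L: "\<And>u v. L u = L v \<longleftrightarrow> (u, v) \<in> (Restr arcs (outside E x y))\<^sup>*"
  shows "(\<forall>a<n. nbrs_reached (closed_nbhd E x) (closed_nbhd E y) L a) \<longleftrightarrow> avoidable_edge {..<n} E {x, y}"
proof -
  have "a < n" if "a \<in> closed_nbhd E x" for a
    using that x_less ugraph_edgeD(2)[OF g] by (auto simp: closed_nbhd_def)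
  moreover have "arcs `` {y} - closed_nbhd E x = closed_nbhd E y - closed_nbhd E x"
    using xy by (auto simp: arcs closed_nbhd_def)
  ultimately show ?thesis
    unfolding avoidable_edge_iff[OF g xy] nbrs_reached_def outside_def[symmetric]
    using mem_reached_iff[OF arcs L] by blast
qed

lemma answers_within_avoidable_prog:
  assumes g: "ugraph {..<n} E" and arcs: "arcs = adj E" and xy: "{x, y} \<in> E"
  shows "answers_within (compile 0 avoidable_prog) (encode n es x y) (avoidable_edge {..<n} E {x, y})
    (cost bounds avoidable_prog)"
proof (rule answers_within_compile, rule wp_conseq[OF wp_avoidable_prog])
  have nbhd: "{v} \<union> arcs `` {v} = closed_nbhd E v" for v
    by (simp add: arcs closed_nbhd_def)
  fix R M
  assume "\<exists>L. (\<forall>u v. L u = L v \<longleftrightarrow>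
      (u, v) \<in> (Restr arcs (- (({x} \<union> arcs `` {x}) \<union> ({y} \<union> arcs `` {y}))))\<^sup>*) \<and>
    R r_ans = of_bool (\<forall>a<n. nbrs_reached ({x} \<union> arcs `` {x}) ({y} \<union> arcs `` {y}) L a)"
  then show "R 0 = (if avoidable_edge {..<n} E {x, y} then 1 else 0)"
    unfolding nbhd outside_def[symmetric] of_bool_def
    using nbrs_reached_iff_avoidable_edge[OF g arcs xy] by auto
qed

end

lemma edge_list_if_lists_edges:
  assumes "ugraph {..<n} E" "lists_edges es E" "{x, y} \<in> E"
  shows "edge_list n es x y"
proof
  have "(u, v) \<in> set es \<Longrightarrow> {u, v} \<in> E" for u v
    using assms(2) by (force simp: lists_edges_def)
  then show "(u, v) \<in> set es \<Longrightarrow> u < n \<and> v < n" for u v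
    using ugraph_edgeD[OF assms(1)] by blast
  show "x < n" "y < n" "x \<noteq> y"
    using ugraph_edgeD[OF assms(1,3)] by simp_all
qed

lemma (in edge_list) arcs_eq_adj: "lists_edges es E \<Longrightarrow> arcs = adj E"
  by (auto simp: lists_edges_def arcs_def adj_def doubleton_eq_iff image_iff split: prod.splits)

lemma length_eq_card_if_lists_edges: "lists_edges es E \<Longrightarrow> length es = card E"
  using distinct_card[of "map (\<lambda>(u, v). {u, v}) es"] by (simp add: lists_edges_def)

theorem theorem30:
  "\<exists>(P :: program) (C :: nat). \<forall>(n :: nat) (m :: nat) (E :: nat set set) (es :: (nat \<times> nat) list)
      (x :: nat) (y :: nat).
     ugraph {..<n} E \<and> card E = m \<and> lists_edges es E \<and> {x, y} \<in> E \<longrightarrow>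
     answers_within P (encode n es x y) (avoidable_edge {..<n} E {x, y}) (C * (n * m))"
proof (rule exI[of _ "compile 0 avoidable_prog"], rule exI[of _ 301], intro allI impI, elim conjE)
  fix n m E es x y
  assume g: "ugraph {..<n} E" and m: "card E = m" and es: "lists_edges es E" and xy: "{x, y} \<in> E"
  interpret edge_list n es x y
    using g es xy by (rule edge_list_if_lists_edges)
  have length: "length es = m" using length_eq_card_if_lists_edges[OF es] m by simp
  have "1 \<le> n" "1 \<le> m"
    using x_less xy es by (auto simp: length[symmetric] Suc_le_eq lists_edges_def)
  then have "cost bounds avoidable_prog \<le> 301 * (n * m)"
    unfolding length by (rule cost_avoidable_prog_le)
  with answers_within_avoidable_prog[OF g arcs_eq_adj[OF es] xy]
  show "answers_within (compile 0 avoidable_prog) (encode n es x y) (avoidable_edge {..<n} E {x, y}) (301 * (n * m))"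
    by (rule answers_within_mono)
qed

end
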